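(* A Darboux cyclide in $\mathbb{R}^3$ is not Möbius equivalent to both a Bohemian surface and a Cliffordian surface.
   Context: A surface means a real irreducible algebraic surface. A generalized circle is a circle or a line. $S^3\subset\mathbb{R}^4$ is the unit sphere and $\mu\colon S^3\dashrightarrow\mathbb{R}^3$, $\mu(y)=(y_1,y_2,y_3)/(1-y_4)$, is stereographic projection from $(0,0,0,1)$. A Darboux cyclide is a surface $Z\subset\mathbb{R}^3$ of Möbius degree four, i.e. such that the Zariski closure of $\mu^{-1}(Z)$ in $\mathbb{P}^4$ has degree four. An inversion with respect to a sphere in $\mathbb{R}^3$ with center $c$ and radius $r$ is the map $f\colon\mathbb{R}^3\setminus\{c\}\to\mathbb{R}^3\setminus\{c\}$ such that $\|x-c\|\cdot\|f(x)-c\|=r^2$ and $x-c$, $f(x)-c$ are codirected. Two surfaces in $\mathbb{R}^3$ are Möbius equivalent if one is mapped to the other by a composition of inversions. Identify $S^3$ with the unit quaternions and let $\star$ be the Hamiltonian product. Put $A+B=\{a+b\mid a\in A,b\in B\}$ for curves $A,B\subset\mathbb{R}^3$ and $A\star B=\{a\star b\mid a\in A,b\in B\}$ for curves $A,B\subset S^3$. A surface $Z\subset\mathbb{R}^3$ is Bohemian (resp. Cliffordian) if there exist generalized circles $A,B\subset\mathbb{R}^3$ (resp. circles $A,B\subset S^3$) such that $Z$ is the Zariski closure of $A+B$ (resp. of $\mu(A\star B)$). *)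

theory Defs
  imports
    "HOL-Analysis.Analysis"
    "HOL-Library.Function_Algebras"
    "HOL-Library.Extended_Nat"
    "HOL-Computational_Algebra.Polynomial"
begin

section \<open>Real algebraic sets in Euclidean space\<close>

definition zariski_closed :: "'a::euclidean_space set \<Rightarrow> bool" where
  "zariski_closed Z \<longleftrightarrow>
     (\<exists>P. (\<forall>p\<in>P. real_polynomial_function p) \<and> Z = {x. \<forall>p\<in>P. p x = 0})"

abbreviation zariski_closure :: "'a::euclidean_space set \<Rightarrow> 'a set" where
  "zariski_closure S \<equiv> zariski_closed hull S"

definition zariski_irreducible :: "'a::euclidean_space set \<Rightarrow> bool" where
  "zariski_irreducible Z \<longleftrightarrow> Z \<noteq> {} \<and>
     (\<forall>F G. zariski_closed F \<longrightarrow> zariski_closed G \<longrightarrow> Z \<subseteq> F \<union> G \<longrightarrow> Z \<subseteq> F \<or> Z \<subseteq> G)"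

text \<open>Krull dimension of the Zariski topology on a closed set.\<close>

definition zariski_dim :: "'a::euclidean_space set \<Rightarrow> enat" where
  "zariski_dim Z = Sup {enat n | n. \<exists>C :: nat \<Rightarrow> 'a set.
     (\<forall>i\<le>n. zariski_closed (C i) \<and> zariski_irreducible (C i) \<and> C i \<subseteq> Z) \<and>
     (\<forall>i<n. C i \<subset> C (Suc i))}"

definition surface :: "'a::euclidean_space set \<Rightarrow> bool" where
  "surface Z \<longleftrightarrow> zariski_closed Z \<and> zariski_irreducible Z \<and> zariski_dim Z = 2"


section \<open>Projective closure and degree\<close>

text \<open>
  Complex projective \<open>n\<close>-space is described by nonzero homogeneous coordinate vectors
  indexed by \<^typ>\<open>'n option\<close>, where \<^term>\<open>None\<close> is the index of the homogenizing
  coordinate. Subsets of projective space are given by the set of all homogeneous coordinate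
  vectors of their points.
\<close>

definition homog :: "real ^ 'n \<Rightarrow> complex ^ ('n option)" where
  "homog y = (\<chi> i. case i of None \<Rightarrow> 1 | Some j \<Rightarrow> complex_of_real (y $ j))"

interpretation complex_fun: vector_space "\<lambda>(c::complex) (f :: 'a \<Rightarrow> complex) x. c * f x"
  by unfold_locales (auto simp: fun_eq_iff algebra_simps)

definition monomials :: "nat \<Rightarrow> (complex ^ 'm \<Rightarrow> complex) set" where
  "monomials d = {\<lambda>v. \<Prod>i\<in>UNIV. (v $ i) ^ e i | e :: 'm \<Rightarrow> nat. (\<Sum>i\<in>UNIV. e i) = d}"

definition forms :: "nat \<Rightarrow> (complex ^ 'm \<Rightarrow> complex) set" where
  "forms d = complex_fun.span (monomials d)"

definition projective_closure :: "(real ^ 'n) set \<Rightarrow> (complex ^ ('n option)) set" where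
  "projective_closure X =
     {v. v \<noteq> 0 \<and> (\<forall>d. \<forall>F\<in>forms d. (\<forall>y\<in>X. F (homog y) = 0) \<longrightarrow> F v = 0)}"

text \<open>
  Two forms of degree \<open>d\<close> have the same restriction to \<open>V\<close> iff their difference lies in the
  homogeneous ideal of \<open>V\<close>. Hence the restrictions form a copy of the degree \<open>d\<close> part of the
  homogeneous coordinate ring of \<open>V\<close>.
\<close>

definition hilbert_function :: "(complex ^ 'm) set \<Rightarrow> nat \<Rightarrow> nat" where
  "hilbert_function V d =
     complex_fun.dim ((\<lambda>F v. if v \<in> V then F v else 0) ` forms d)"

definition hilbert_polynomial :: "(complex ^ 'm) set \<Rightarrow> real poly" where
  "hilbert_polynomial V =
     (THE P. \<forall>\<^sub>F d in sequentially. real (hilbert_function V d) = poly P (real d))"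

definition projective_degree :: "(complex ^ 'm) set \<Rightarrow> real" where
  "projective_degree V =
     fact (degree (hilbert_polynomial V)) * lead_coeff (hilbert_polynomial V)"


section \<open>Stereographic projection and Darboux cyclides\<close>

abbreviation S3 :: "(real ^ 4) set" where
  "S3 \<equiv> sphere 0 1"

abbreviation north_pole :: "real ^ 4" where
  "north_pole \<equiv> axis 4 1"

definition stereo :: "real ^ 4 \<Rightarrow> real ^ 3" where
  "stereo y = vector [y $ 1 / (1 - y $ 4), y $ 2 / (1 - y $ 4), y $ 3 / (1 - y $ 4)]"

definition moebius_degree :: "(real ^ 3) set \<Rightarrow> real" where
  "moebius_degree Z =
     projective_degree (projective_closure {y \<in> S3 - {north_pole}. stereo y \<in> Z})"

definition darboux_cyclide :: "(real ^ 3) set \<Rightarrow> bool" where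
  "darboux_cyclide Z \<longleftrightarrow> surface Z \<and> moebius_degree Z = 4"


section \<open>Moebius equivalence\<close>

definition inversion :: "'a::euclidean_space \<Rightarrow> real \<Rightarrow> 'a \<Rightarrow> 'a" where
  "inversion c r x = c + (r\<^sup>2 / (norm (x - c))\<^sup>2) *\<^sub>R (x - c)"

lemma inversion_norm:
  assumes "x \<noteq> c"
  shows "norm (x - c) * norm (inversion c r x - c) = r\<^sup>2"
  using assms by (simp add: inversion_def power2_eq_square)

lemma inversion_codirected:
  assumes "x \<noteq> c" "r > 0"
  shows "\<exists>t>0. inversion c r x - c = t *\<^sub>R (x - c)"
  using assms by (intro exI[of _ "r\<^sup>2 / (norm (x - c))\<^sup>2"]) (auto simp: inversion_def)

text \<open>
  \<open>inversion_composition f D\<close>: the map \<open>f\<close> is a composition of inversions, and \<open>D\<close> is the set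
  of points at which all the successive inversions are defined.
\<close>

inductive inversion_composition ::
    "('a::euclidean_space \<Rightarrow> 'a) \<Rightarrow> 'a set \<Rightarrow> bool" where
  identity: "inversion_composition id UNIV"
| inversion: "\<lbrakk>inversion_composition f D; r > 0\<rbrakk>
    \<Longrightarrow> inversion_composition (inversion c r \<circ> f) {x \<in> D. f x \<noteq> c}"

text \<open>
  Since inversions are undefined at their centers, a surface is mapped to the Zariski closure of
  the image of its points in \<open>D\<close>; for example, a plane is mapped to a full sphere.
\<close>

definition moebius_maps_to :: "'a::euclidean_space set \<Rightarrow> 'a set \<Rightarrow> bool" where
  "moebius_maps_to Z W \<longleftrightarrow>
     (\<exists>f D. inversion_composition f D \<and> W = zariski_closure (f ` (Z \<inter> D)))"

definition moebius_equivalent :: "'a::euclidean_space set \<Rightarrow> 'a set \<Rightarrow> bool" where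
  "moebius_equivalent Z W \<longleftrightarrow> moebius_maps_to Z W \<or> moebius_maps_to W Z"


section \<open>Bohemian and Cliffordian surfaces\<close>

definition circle :: "'a::euclidean_space set \<Rightarrow> bool" where
  "circle C \<longleftrightarrow>
     (\<exists>P c r. affine P \<and> aff_dim P = 2 \<and> c \<in> P \<and> r > 0 \<and> C = P \<inter> sphere c r)"

definition line :: "'a::euclidean_space set \<Rightarrow> bool" where
  "line L \<longleftrightarrow> affine L \<and> aff_dim L = 1"

definition generalized_circle :: "'a::euclidean_space set \<Rightarrow> bool" where
  "generalized_circle C \<longleftrightarrow> circle C \<or> line C"

text \<open>
  The vector \<open>(y\<^sub>1, y\<^sub>2, y\<^sub>3, y\<^sub>4)\<close> is identified with the quaternion
  \<open>y\<^sub>1 + y\<^sub>2 i + y\<^sub>3 j + y\<^sub>4 k\<close>.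
\<close>

definition hamilton :: "real ^ 4 \<Rightarrow> real ^ 4 \<Rightarrow> real ^ 4"  (infixl \<open>\<star>\<close> 70) where
  "a \<star> b = vector
     [a $ 1 * b $ 1 - a $ 2 * b $ 2 - a $ 3 * b $ 3 - a $ 4 * b $ 4,
      a $ 1 * b $ 2 + a $ 2 * b $ 1 + a $ 3 * b $ 4 - a $ 4 * b $ 3,
      a $ 1 * b $ 3 - a $ 2 * b $ 4 + a $ 3 * b $ 1 + a $ 4 * b $ 2,
      a $ 1 * b $ 4 + a $ 2 * b $ 3 - a $ 3 * b $ 2 + a $ 4 * b $ 1]"

definition bohemian :: "(real ^ 3) set \<Rightarrow> bool" where
  "bohemian Z \<longleftrightarrow> surface Z \<and>
     (\<exists>A B. generalized_circle A \<and> generalized_circle B \<and>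
        Z = zariski_closure {a + b | a b. a \<in> A \<and> b \<in> B})"

definition cliffordian :: "(real ^ 3) set \<Rightarrow> bool" where
  "cliffordian Z \<longleftrightarrow> surface Z \<and>
     (\<exists>A B. circle A \<and> A \<subseteq> S3 \<and> circle B \<and> B \<subseteq> S3 \<and>
        Z = zariski_closure (stereo ` ({a \<star> b | a b. a \<in> A \<and> b \<in> B} - {north_pole})))"

end

theory Submission
  imports Defs
begin

text \<open>
  The surfaces are told apart by isotropic complex lines. Points of \<open>\<real>\<^sup>3\<close> are lifted to the cone
  \<open>\<bar>x\<bar>\<^sup>2 = u v\<close> in \<open>\<real>\<^sup>5\<close>, on which inversions act linearly, so a homogeneous equation of a surface
  can be carried along a Moebius equivalence (\<open>moebius_equivalent_transfer\<close>). The complex lines in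
  this cone are, apart from those at infinity, the lines of \<open>\<complex>\<^sup>3\<close> whose direction \<open>d\<close> satisfies
  \<open>d \<bullet> d = 0\<close>.

  A Bohemian surface is contained in a plane, an elliptic or circular cylinder, or the quartic
  generated by the sums of two circles in transversal planes. The complex zeros of the equations of
  the cylinder and of the quartic contain no isotropic line (\<open>bohemian_has_form\<close>).

  For a Cliffordian surface \<open>A \<star> B\<close>, let \<open>e - \<i> f\<close> be a complex point at infinity of the circle \<open>A\<close>.
  It is a zero divisor, so the products \<open>(e - \<i> f) h\<close> with quaternions \<open>h\<close> form only a complex plane,
  that is, a projective line in the complex cone. A form that vanishes on \<open>A \<star> B\<close> vanishes at
  \<open>(e - \<i> f) b\<close> for all \<open>b \<in> B\<close>; unless all these points coincide projectively, it vanishes on the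
  line. The image of this line under every conformal map is an isotropic line of \<open>\<complex>\<^sup>3\<close>, and not a line
  at infinity, because the real vectors \<open>(e h, 0)\<close> are not null. This is incompatible with the
  equations of the cylinder and of the quartic. A real linear equation that vanishes on the line
  vanishes on the whole hyperplane at infinity of \<open>S\<^sup>3\<close>, and hence nowhere on \<open>S\<^sup>3\<close>, which excludes
  the plane (\<open>cliffordian_one_sided\<close>).

  The same argument applies with \<open>A\<close> and \<open>B\<close> exchanged. If the points coincide on both sides, then
  \<open>A\<close> and \<open>B\<close> are cosets of one circle group and \<open>A \<star> B\<close> is a great circle, not a surface
  (\<open>cliffordian_great_circle\<close>, \<open>great_circle_not_surface\<close>).
\<close>

section \<open>Real forms on complexified vector spaces\<close>

text \<open>
  A complex vector \<open>p + \<i> q\<close> over a real vector space is the pair \<open>(p, q)\<close>. Real linear maps and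
  functionals then extend componentwise, which keeps the theory of real linear maps available.
\<close>

definition cscale :: "complex \<Rightarrow> 'a::real_vector \<times> 'a \<Rightarrow> 'a \<times> 'a" where
  "cscale c z = (Re c *\<^sub>R fst z - Im c *\<^sub>R snd z, Re c *\<^sub>R snd z + Im c *\<^sub>R fst z)"

definition cx :: "('a \<Rightarrow> real) \<Rightarrow> 'a \<times> 'a \<Rightarrow> complex" where
  "cx \<phi> z = Complex (\<phi> (fst z)) (\<phi> (snd z))"

lemma cx_cscale: "linear \<phi> \<Longrightarrow> cx \<phi> (cscale c z) = c * cx \<phi> z"
  by (simp add: cx_def cscale_def complex_eq_iff linear_add linear_diff linear_scale)

lemma cx_add: "linear \<phi> \<Longrightarrow> cx \<phi> (z + w) = cx \<phi> z + cx \<phi> w"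
  by (simp add: cx_def complex_eq_iff linear_add)

lemma cx_real: "linear \<phi> \<Longrightarrow> cx \<phi> (x, 0) = of_real (\<phi> x)"
  by (simp add: cx_def complex_eq_iff linear_0)

lemma cscale_cscale: "cscale c (cscale d z) = cscale (c * d) z"
  by (simp add: cscale_def prod_eq_iff algebra_simps)

lemma cscale_1 [simp]: "cscale 1 z = z"
  by (simp add: cscale_def)

lemma cscale_0 [simp]: "cscale 0 z = 0"
  by (simp add: cscale_def zero_prod_def)

lemma cscale_add: "cscale c (z + w) = cscale c z + cscale c w"
  by (simp add: cscale_def prod_eq_iff algebra_simps)

lemma cscale_of_real: "cscale (of_real t) (x, 0) = (t *\<^sub>R x, 0)"
  by (simp add: cscale_def)

text \<open>
  Homogeneous polynomials of degree \<open>n\<close> with real coefficients, as functions on the complexification.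
\<close>

inductive real_form :: "nat \<Rightarrow> ('a::real_vector \<times> 'a \<Rightarrow> complex) \<Rightarrow> bool" where
  const: "real_form 0 (\<lambda>_. of_real c)"
| linear: "linear \<phi> \<Longrightarrow> real_form 1 (cx \<phi>)"
| add: "real_form n F \<Longrightarrow> real_form n G \<Longrightarrow> real_form n (\<lambda>z. F z + G z)"
| mult: "real_form n F \<Longrightarrow> real_form m G \<Longrightarrow> real_form (n + m) (\<lambda>z. F z * G z)"

lemma real_form_scale: "real_form n F \<Longrightarrow> real_form n (\<lambda>z. of_real c * F z)"
  using real_form.mult[OF real_form.const, of n F c] by simp

lemma real_form_diff:
  assumes "real_form n F" "real_form n G"
  shows "real_form n (\<lambda>z. F z - G z)"
  using real_form.add[OF assms(1) real_form_scale[OF assms(2), of "-1"]] by simp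

lemma real_form_power: "real_form n F \<Longrightarrow> real_form (k * n) (\<lambda>z. F z ^ k)"
proof (induction k)
  case 0
  show ?case using real_form.const[of 1] by simp
next
  case (Suc k)
  then show ?case using real_form.mult[of n F "k * n"] by simp
qed

lemma real_form_homogeneous: "real_form n F \<Longrightarrow> F (cscale c z) = c ^ n * F z"
  by (induction rule: real_form.induct) (simp_all add: cx_cscale power_add algebra_simps)

lemma real_form_scaleR: "real_form n F \<Longrightarrow> F (t *\<^sub>R x, 0) = of_real t ^ n * F (x, 0)"
  using real_form_homogeneous[of n F "of_real t" "(x, 0)"] by (simp add: cscale_of_real)

lemma real_form_comp:
  assumes "real_form n F" "linear T"
  shows "real_form n (\<lambda>z. F (map_prod T T z))"
  using assms
proof (induction rule: real_form.induct)
  case (linear \<phi>)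
  have "(\<lambda>z. cx \<phi> (map_prod T T z)) = cx (\<phi> \<circ> T)"
    by (auto simp: cx_def)
  then show ?case
    using real_form.linear[OF linear_compose[OF linear.prems linear.hyps]] by simp
qed (auto intro: real_form.intros)

text \<open>
  The value of a form at a complex point at infinity of a circle is a leading coefficient of the
  form along the circle. This is how vanishing on real circles gives vanishing at complex points.
\<close>

lemma real_form_along_curve:
  assumes "real_form n F"
    and "\<And>\<phi>. linear \<phi> \<Longrightarrow>
      \<exists>P. degree P \<le> m \<and> coeff P m = cx \<phi> p \<and> (\<forall>t. cx \<phi> (z t) = poly P t)"
  shows "\<exists>P. degree P \<le> n * m \<and> coeff P (n * m) = F p \<and> (\<forall>t. F (z t) = poly P t)"
  using assms
proof (induction rule: real_form.induct)
  case (const c)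
  then show ?case by (intro exI[of _ "[:of_real c:]"]) simp
next
  case (linear \<phi>)
  then show ?case by simp
next
  case (add n F G)
  then obtain P Q where
    "degree P \<le> n * m" "coeff P (n * m) = F p" "\<forall>t. F (z t) = poly P t"
    "degree Q \<le> n * m" "coeff Q (n * m) = G p" "\<forall>t. G (z t) = poly Q t"
    by blast
  then show ?case by (intro exI[of _ "P + Q"]) (auto intro: degree_add_le)
next
  case (mult n F k G)
  then obtain P Q where *:
    "degree P \<le> n * m" "coeff P (n * m) = F p" "\<forall>t. F (z t) = poly P t"
    "degree Q \<le> k * m" "coeff Q (k * m) = G p" "\<forall>t. G (z t) = poly Q t"
    by blast
  have "coeff (P * Q) (n * m + k * m) = F p * G p"
  proof (cases "degree P = n * m \<and> degree Q = k * m")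
    case True
    then show ?thesis using * coeff_mult_degree_sum[of P Q] by simp
  next
    case False
    then have "degree P < n * m \<or> degree Q < k * m" "degree P + degree Q < n * m + k * m"
      using * by linarith+
    then have "coeff P (n * m) = 0 \<or> coeff Q (k * m) = 0" "degree P + degree Q < n * m + k * m"
      by (auto intro: coeff_eq_0)
    then show ?thesis
      using * degree_mult_le[of P Q] by (metis coeff_eq_0 le_less_trans mult_eq_0_iff)
  qed
  moreover have "degree (P * Q) \<le> n * m + k * m"
    using * degree_mult_le[of P Q] by linarith
  ultimately show ?case
    using * by (intro exI[of _ "P * Q"]) (auto simp: algebra_simps)
qed

lemma real_form_along_line:
  assumes "real_form n F"
  shows "\<exists>P. degree P \<le> n \<and> coeff P n = F p \<and> (\<forall>t. F (cscale t p + q) = poly P t)"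
proof -
  have "\<exists>P. degree P \<le> 1 \<and> coeff P 1 = cx \<phi> p \<and> (\<forall>t. cx \<phi> (cscale t p + q) = poly P t)"
    if "linear \<phi>" for \<phi>
    using that by (intro exI[of _ "[:cx \<phi> q, cx \<phi> p:]"]) (simp add: cx_add cx_cscale)
  from real_form_along_curve[OF assms this] show ?thesis by simp
qed

text \<open>
  With \<open>\<omega> = cis \<theta>\<close>, the point \<open>c + cos \<theta> e + sin \<theta> f\<close> times \<open>\<omega>\<close> is a quadratic polynomial in
  \<open>\<omega>\<close> with leading coefficient \<open>(e - \<i> f) / 2\<close>.
\<close>

lemma real_form_along_ellipse:
  fixes c e f :: "'a::real_vector"
  assumes "real_form n F"
  obtains P where "coeff P (2 * n) = F (e, - f) / 2 ^ n"
    and "\<And>\<theta>::real. cis \<theta> ^ n * F (c + cos \<theta> *\<^sub>R e + sin \<theta> *\<^sub>R f, 0) = poly P (cis \<theta>)"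
proof -
  define p where "p = cscale (1/2) (e, - f)"
  define r where "r = cscale (1/2) (e, f)"
  define z where "z \<omega> = cscale (\<omega>\<^sup>2) p + cscale \<omega> (c, 0) + r" for \<omega>
  have "\<exists>P. degree P \<le> 2 \<and> coeff P 2 = cx \<phi> p \<and> (\<forall>t. cx \<phi> (z t) = poly P t)"
    if "linear \<phi>" for \<phi>
    using that
    by (intro exI[of _ "[:cx \<phi> r, cx \<phi> (c, 0), cx \<phi> p:]"])
      (simp add: z_def cx_add cx_cscale power2_eq_square algebra_simps numeral_2_eq_2)
  from real_form_along_curve[OF assms this] obtain P
    where P: "coeff P (n * 2) = F p" "\<And>t. F (z t) = poly P t" by blast
  show ?thesis
  proof
    show "coeff P (2 * n) = F (e, - f) / 2 ^ n"
      using P(1) real_form_homogeneous[OF assms, of "1/2" "(e, - f)"]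
      by (simp add: p_def mult.commute power_one_over field_simps)
    fix \<theta> :: real
    have trig: "cos \<theta> * cos \<theta> = 1 - sin \<theta> * sin \<theta>"
      using sin_cos_squared_add[of \<theta>] by (simp add: power2_eq_square)
    have 1: "(cis \<theta>)\<^sup>2 = Complex (1 - 2 * (sin \<theta> * sin \<theta>)) (2 * (cos \<theta> * sin \<theta>))"
      by (simp add: power2_eq_square complex_eq_iff trig)
    have "cscale (cis \<theta>) (c + cos \<theta> *\<^sub>R e + sin \<theta> *\<^sub>R f, 0) = z (cis \<theta>)"
      unfolding z_def p_def r_def 1
      by (simp add: cscale_def prod_eq_iff algebra_simps trig scaleR_left_diff_distrib
          flip: scaleR_left_distrib)
    then show "cis \<theta> ^ n * F (c + cos \<theta> *\<^sub>R e + sin \<theta> *\<^sub>R f, 0) = poly P (cis \<theta>)"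
      using P(2) real_form_homogeneous[OF assms] by metis
  qed
qed

lemma inj_on_cis: "inj_on cis {0..<2 * pi}"
proof (rule inj_onI)
  fix x y :: real assume xy: "x \<in> {0..<2 * pi}" "y \<in> {0..<2 * pi}" and "cis x = cis y"
  then have "sin x = sin y \<and> cos x = cos y" by (simp add: complex_eq_iff)
  then obtain k :: int where k: "x = y + 2 * pi * k"
    unfolding sin_cos_eq_iff by blast
  have "0 \<le> x" "x < 2 * pi" "0 \<le> y" "y < 2 * pi" using xy by auto
  then have "2 * pi * k < 2 * pi * 1" "2 * pi * (-1) < 2 * pi * k"
    using k by linarith+
  then have "real_of_int k < 1" "-1 < real_of_int k"
    using mult_less_cancel_left_pos[of "2 * pi"] pi_gt_zero by (metis mult_pos_pos zero_less_numeral)+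
  then have "k = 0" by linarith
  then show "x = y" using k by simp
qed

lemma poly_eq_0_if_zero_at_cis:
  assumes "infinite \<Theta>" "\<Theta> \<subseteq> {0..<2 * pi}" "\<And>\<theta>. \<theta> \<in> \<Theta> \<Longrightarrow> poly P (cis \<theta>) = 0"
  shows "P = 0"
proof (rule ccontr)
  assume "P \<noteq> 0"
  then have "finite (cis ` \<Theta>)"
    using assms(3) by (auto intro: finite_subset[OF _ poly_roots_finite[of P]])
  moreover have "inj_on cis \<Theta>"
    using inj_on_cis assms(2) by (rule inj_on_subset)
  ultimately show False
    using assms(1) finite_imageD by blast
qed

lemma real_form_on_ellipse:
  fixes c e f :: "'a::real_vector"
  assumes F: "real_form n F" and \<Theta>: "infinite \<Theta>" "\<Theta> \<subseteq> {0..<2 * pi}"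
    and zero: "\<And>\<theta>. \<theta> \<in> \<Theta> \<Longrightarrow> F (c + cos \<theta> *\<^sub>R e + sin \<theta> *\<^sub>R f, 0) = 0"
  shows "F (e, - f) = 0" and "F (c + cos \<theta> *\<^sub>R e + sin \<theta> *\<^sub>R f, 0) = 0"
proof -
  obtain P where P: "coeff P (2 * n) = F (e, - f) / 2 ^ n"
    "\<And>\<theta>::real. cis \<theta> ^ n * F (c + cos \<theta> *\<^sub>R e + sin \<theta> *\<^sub>R f, 0) = poly P (cis \<theta>)"
    using real_form_along_ellipse[OF F] by metis
  have "poly P (cis \<theta>) = 0" if "\<theta> \<in> \<Theta>" for \<theta>
    using P(2)[of \<theta>] zero[OF that] by simp
  then have "P = 0" by (rule poly_eq_0_if_zero_at_cis[OF \<Theta>])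
  then show "F (e, - f) = 0" "F (c + cos \<theta> *\<^sub>R e + sin \<theta> *\<^sub>R f, 0) = 0"
    using P(1) P(2)[of \<theta>] by simp_all
qed

lemma trig_eq_0_if_infinitely_many_zeros:
  fixes a b c :: complex
  assumes \<Theta>: "infinite \<Theta>" "\<Theta> \<subseteq> {0..<2 * pi}"
    and zero: "\<And>\<theta>. \<theta> \<in> \<Theta> \<Longrightarrow> c + of_real (cos \<theta>) * a + of_real (sin \<theta>) * b = 0"
  shows "c + of_real (cos \<theta>) * a + of_real (sin \<theta>) * b = 0"
proof -
  define P where "P = [:(a + \<i> * b) / 2, c, (a - \<i> * b) / 2:]"
  have P: "cis \<theta> * (c + of_real (cos \<theta>) * a + of_real (sin \<theta>) * b) = poly P (cis \<theta>)" for \<theta>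
  proof -
    define C S where "C = complex_of_real (cos \<theta>)" and "S = complex_of_real (sin \<theta>)"
    have "S\<^sup>2 + C\<^sup>2 = 1"
      unfolding C_def S_def
      by (metis of_real_1 of_real_add of_real_power sin_cos_squared_add)
    then have 2: "C * C = 1 - S * S" by (simp add: power2_eq_square algebra_simps)
    have "cis \<theta> = C + \<i> * S" by (simp add: C_def S_def complex_eq_iff)
    moreover have "(C + \<i> * S) * (c + C * a + S * b) = poly P (C + \<i> * S)"
    proof -
      have "2 * ((C + \<i> * S) * (c + C * a + S * b) - poly P (C + \<i> * S))
          = (C * C + S * S - 1) * (a + \<i> * b)"
        unfolding P_def by (simp add: field_simps)
      then show ?thesis using 2 by simp
    qed
    ultimately show ?thesis by (simp add: C_def S_def)
  qed
  have "P = 0"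
    by (rule poly_eq_0_if_zero_at_cis[OF \<Theta>]) (metis P zero mult_zero_right)
  then show ?thesis using P[of \<theta>] by simp
qed

text \<open>
  The directions \<open>\<sigma> z1 + \<tau> z2\<close> take infinitely many values in the projective line: otherwise one
  linear factor \<open>\<sigma> - \<rho> \<tau>\<close> would vanish for infinitely many parameters, hence identically. But a form
  on a complex plane that is not zero has only finitely many roots on the projective line.
\<close>

lemma real_form_on_plane:
  fixes z1 z2 :: "'a::real_vector \<times> 'a" and \<sigma> \<tau> :: "real \<Rightarrow> complex"
  assumes F: "real_form n F"
    and zero: "\<And>\<theta>. F (cscale (\<sigma> \<theta>) z1 + cscale (\<tau> \<theta>) z2) = 0"
    and \<sigma>: "\<And>\<theta>. \<sigma> \<theta> = s0 + of_real (cos \<theta>) * s1 + of_real (sin \<theta>) * s2"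
    and \<tau>: "\<And>\<theta>. \<tau> \<theta> = t0 + of_real (cos \<theta>) * t1 + of_real (sin \<theta>) * t2"
    and \<alpha>: "\<sigma> \<alpha> = 1" "\<tau> \<alpha> = 0" and \<beta>: "\<sigma> \<beta> = 0" "\<tau> \<beta> = 1"
  shows "F (cscale s z1 + cscale t z2) = 0"
proof -
  obtain P where P: "coeff P n = F z1" "\<And>t. F (cscale t z1 + z2) = poly P t"
    using real_form_along_line[OF F] by blast
  have ratio: "F (cscale s z1 + cscale t z2) = t ^ n * poly P (s / t)" if "t \<noteq> 0" for s t
    using that P(2)[of "s / t"] real_form_homogeneous[OF F, of t "cscale (s / t) z1 + z2"]
    by (simp add: cscale_add cscale_cscale)
  have "P = 0"
  proof (rule ccontr)
    assume "P \<noteq> 0"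
    then have fin: "finite {\<rho>. poly P \<rho> = 0}" by (rule poly_roots_finite)
    define \<Theta> where "\<Theta> = {\<theta> \<in> {0..<2 * pi}. \<tau> \<theta> \<noteq> 0}"
    have all: "infinite {0..<2 * pi}" by (simp add: infinite_Ico)
    have "finite {\<theta> \<in> {0..<2 * pi}. \<tau> \<theta> = 0}"
    proof (rule ccontr)
      assume "infinite {\<theta> \<in> {0..<2 * pi}. \<tau> \<theta> = 0}"
      then have "\<tau> \<beta> = 0"
        unfolding \<tau> by (rule trig_eq_0_if_infinitely_many_zeros) auto
      then show False using \<beta> by simp
    qed
    moreover have "{0..<2 * pi} = \<Theta> \<union> {\<theta> \<in> {0..<2 * pi}. \<tau> \<theta> = 0}"
      by (auto simp: \<Theta>_def)
    ultimately have inf: "infinite \<Theta>" using all by (metis finite_Un)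
    have "poly P (\<sigma> \<theta> / \<tau> \<theta>) = 0" if "\<theta> \<in> \<Theta>" for \<theta>
      using ratio[of "\<tau> \<theta>" "\<sigma> \<theta>"] zero[of \<theta>] that by (simp add: \<Theta>_def)
    then have "finite ((\<lambda>\<theta>. \<sigma> \<theta> / \<tau> \<theta>) ` \<Theta>)"
      by (intro finite_subset[OF _ fin]) auto
    from pigeonhole_infinite[OF inf this]
    obtain \<rho> where \<rho>: "infinite {\<theta> \<in> \<Theta>. \<sigma> \<theta> / \<tau> \<theta> = \<rho>}" by blast
    have eq: "(s0 - \<rho> * t0) + of_real (cos \<theta>) * (s1 - \<rho> * t1)
        + of_real (sin \<theta>) * (s2 - \<rho> * t2) = \<sigma> \<theta> - \<rho> * \<tau> \<theta>" for \<theta>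
      unfolding \<sigma> \<tau> by (simp add: algebra_simps)
    have "\<sigma> \<alpha> - \<rho> * \<tau> \<alpha> = 0"
      unfolding eq[symmetric]
    proof (rule trig_eq_0_if_infinitely_many_zeros[OF \<rho>])
      show "{\<theta> \<in> \<Theta>. \<sigma> \<theta> / \<tau> \<theta> = \<rho>} \<subseteq> {0..<2 * pi}" by (auto simp: \<Theta>_def)
    qed (auto simp: \<Theta>_def eq)
    then show False using \<alpha> by simp
  qed
  show ?thesis
  proof (cases "t = 0")
    case True
    then show ?thesis
      using P(1) \<open>P = 0\<close> real_form_homogeneous[OF F, of s z1] by simp
  next
    case False
    then show ?thesis using ratio \<open>P = 0\<close> by simp
  qed
qed

section \<open>Inversions as linear maps of the light cone\<close>

text \<open>
  A point \<open>x\<close> of Euclidean space is represented by the null vector \<open>(x, 1, \<bar>x\<bar>\<^sup>2)\<close> of the Lorentzian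
  form \<open>\<bar>x\<bar>\<^sup>2 - u v\<close>. Up to a linear change of coordinates this is the inverse stereographic
  projection to \<open>S\<^sup>3\<close> in homogeneous coordinates, with \<open>u = y\<^sub>0 - y\<^sub>4\<close> and \<open>v = y\<^sub>0 + y\<^sub>4\<close>; the north
  pole is \<open>(0, 0, 1)\<close>.
\<close>

definition lift :: "'a::euclidean_space \<Rightarrow> 'a \<times> real \<times> real" where
  "lift x = (x, 1, x \<bullet> x)"

definition lorentz :: "'a::euclidean_space \<times> real \<times> real \<Rightarrow> real" where
  "lorentz z = fst z \<bullet> fst z - fst (snd z) * snd (snd z)"

definition conformal :: "('a::euclidean_space \<times> real \<times> real \<Rightarrow> 'a \<times> real \<times> real) \<Rightarrow> bool" where
  "conformal T \<longleftrightarrow> linear T \<and> bij T \<and> (\<exists>k. k \<noteq> 0 \<and> (\<forall>z. lorentz (T z) = k * lorentz z))"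

lemma conformal_linear: "conformal T \<Longrightarrow> linear T"
  and conformal_bij: "conformal T \<Longrightarrow> bij T"
  by (auto simp only: conformal_def)

lemma conformal_id: "conformal (\<lambda>z. z)"
proof -
  have "\<exists>k::real. k \<noteq> 0 \<and> (\<forall>z::'a \<times> real \<times> real. lorentz z = k * lorentz z)"
    by (rule exI[of _ 1]) simp
  moreover have "bij (\<lambda>z::'a \<times> real \<times> real. z)" by (simp add: bij_def)
  ultimately show ?thesis unfolding conformal_def using linear_ident by blast
qed

lemma conformal_comp:
  assumes "conformal T" "conformal S"
  shows "conformal (\<lambda>z. T (S z))"
proof -
  obtain k l where "k \<noteq> 0" "l \<noteq> 0" "\<And>z. lorentz (T z) = k * lorentz z" "\<And>z. lorentz (S z) = l * lorentz z"
    using assms unfolding conformal_def by blast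
  then have "k * l \<noteq> 0 \<and> (\<forall>z. lorentz (T (S z)) = (k * l) * lorentz z)" by simp
  moreover have "linear (\<lambda>z. T (S z))" "bij (\<lambda>z. T (S z))"
    using assms linear_compose[of S T] bij_comp[of S T] by (auto simp: conformal_def o_def)
  ultimately show ?thesis unfolding conformal_def by blast
qed

lemma conformal_inv:
  assumes "conformal T"
  shows "conformal (inv T)"
proof -
  have T: "linear T" "bij T" using assms by (auto intro: conformal_linear conformal_bij)
  obtain k where k: "k \<noteq> 0" "\<And>z. lorentz (T z) = k * lorentz z"
    using assms unfolding conformal_def by blast
  have "lorentz (inv T z) = inverse k * lorentz z" for z
    using k(2)[of "inv T z"] k(1) T(2) by (simp add: bij_is_surj surj_f_inv_f)
  moreover have "linear (inv T)"
  proof -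
    have TI: "T (inv T z) = z" for z using T(2) by (simp add: bij_is_surj surj_f_inv_f)
    have IT: "inv T (T z) = z" for z using T(2) by (simp add: bij_is_inj)
    show ?thesis
    proof (rule linearI)
      fix x y r
      show "inv T (x + y) = inv T x + inv T y"
        using IT[of "inv T x + inv T y"] by (simp add: linear_add[OF T(1)] TI)
      show "inv T (r *\<^sub>R x) = r *\<^sub>R inv T x"
        using IT[of "r *\<^sub>R inv T x"] by (simp add: linear_scale[OF T(1)] TI)
    qed
  qed
  ultimately show ?thesis
    unfolding conformal_def using k(1) bij_imp_bij_inv[OF T(2)]
    by (intro conjI exI[of _ "inverse k"]) simp_all
qed

text \<open>
  On a lifted point, \<open>m = \<bar>x - c\<bar>\<^sup>2\<close>. The coordinates of the inverse point have denominator \<open>m\<close>, and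
  the linear expressions below result from multiplying by it.
\<close>

definition inversion_map :: "'a::euclidean_space \<Rightarrow> real \<Rightarrow> 'a \<times> real \<times> real \<Rightarrow> 'a \<times> real \<times> real" where
  "inversion_map c r = (\<lambda>(x, u, v).
     let m = v - 2 * (c \<bullet> x) + (c \<bullet> c) * u; w = x - u *\<^sub>R c
     in (m *\<^sub>R c + r\<^sup>2 *\<^sub>R w, m, (c \<bullet> c) * m + 2 * r\<^sup>2 * (c \<bullet> w) + r ^ 4 * u))"

lemma inversion_map_lift:
  assumes "x \<noteq> c"
  shows "inversion_map c r (lift x) = (norm (x - c))\<^sup>2 *\<^sub>R lift (inversion c r x)"
proof -
  define w where "w = x - c"
  define m where "m = (norm w)\<^sup>2"
  have m: "m \<noteq> 0" "w \<bullet> w = m" using assms by (auto simp: m_def w_def power2_norm_eq_inner)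
  have x: "x = c + w" by (simp add: w_def)
  have i: "inversion c r x = c + (r\<^sup>2 / m) *\<^sub>R w" by (simp add: inversion_def m_def w_def)
  have "x \<bullet> x - 2 * (c \<bullet> x) + c \<bullet> c = m"
    by (simp add: x inner_simps inner_commute m flip: m(2))
  moreover have "m * ((c + (r\<^sup>2 / m) *\<^sub>R w) \<bullet> (c + (r\<^sup>2 / m) *\<^sub>R w))
      = (c \<bullet> c) * m + 2 * r\<^sup>2 * (c \<bullet> w) + r ^ 4"
    using m(1) by (simp add: inner_simps inner_commute m(2) field_simps power2_eq_square power4_eq_xxxx)
  moreover have "m *\<^sub>R (c + (r\<^sup>2 / m) *\<^sub>R w) = m *\<^sub>R c + r\<^sup>2 *\<^sub>R w"
    using m(1) by (simp add: scaleR_add_right)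
  ultimately show ?thesis
    unfolding i lift_def inversion_map_def Let_def m_def[symmetric] w_def[symmetric]
    by (simp add: w_def)
qed

lemma conformal_inversion_map:
  fixes c :: "'a::euclidean_space"
  assumes "r > 0"
  shows "conformal (inversion_map c r)"
proof -
  have lin: "linear (inversion_map c r)"
    by (rule linearI)
      (auto simp: inversion_map_def Let_def inner_simps algebra_simps split: prod.splits)
  have invol: "inversion_map c r (inversion_map c r z) = r ^ 4 *\<^sub>R z" for z
  proof (cases z)
    case (fields x u v)
    define w where "w = x - u *\<^sub>R c"
    define m where "m = v - 2 * (c \<bullet> x) + (c \<bullet> c) * u"
    define V where "V = (c \<bullet> c) * m + 2 * r\<^sup>2 * (c \<bullet> w) + r ^ 4 * u"
    have x: "x = w + u *\<^sub>R c" by (simp add: w_def)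
    have v: "v = m + 2 * (c \<bullet> w) + (c \<bullet> c) * u"
      by (simp add: m_def x inner_simps)
    have m': "V - 2 * (c \<bullet> (m *\<^sub>R c + r\<^sup>2 *\<^sub>R w)) + (c \<bullet> c) * m = r ^ 4 * u"
      by (simp add: V_def inner_simps)
    have "inversion_map c r z = (m *\<^sub>R c + r\<^sup>2 *\<^sub>R w, m, V)"
      unfolding fields inversion_map_def w_def m_def V_def Let_def by simp
    also have "inversion_map c r \<dots> = ((r ^ 4 * u) *\<^sub>R c + r\<^sup>2 *\<^sub>R (r\<^sup>2 *\<^sub>R w), r ^ 4 * u,
        (c \<bullet> c) * (r ^ 4 * u) + 2 * r\<^sup>2 * (c \<bullet> (r\<^sup>2 *\<^sub>R w)) + r ^ 4 * m)"
      unfolding inversion_map_def Let_def prod.case m' by simp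
    also have "\<dots> = r ^ 4 *\<^sub>R z"
      unfolding fields x v
      by (simp add: algebra_simps power2_eq_square power4_eq_xxxx)
    finally show ?thesis .
  qed
  have "lorentz (inversion_map c r z) = r ^ 4 * lorentz z" for z
  proof (cases z)
    case (fields x u v)
    define w where "w = x - u *\<^sub>R c"
    have x: "x = w + u *\<^sub>R c" by (simp add: w_def)
    show ?thesis
      unfolding fields x
      by (simp add: inversion_map_def lorentz_def Let_def inner_simps inner_commute algebra_simps
          power2_eq_square power4_eq_xxxx)
  qed
  moreover have "bij (inversion_map c r)"
  proof (rule bijI)
    show "inj (inversion_map c r)"
      by (rule injI) (metis assms invol less_irrefl scaleR_cancel_left zero_less_power)
    show "surj (inversion_map c r)"
    proof (rule surjI)
      fix z show "inversion_map c r (inverse (r ^ 4) *\<^sub>R inversion_map c r z) = z"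
        using assms by (simp add: linear_scale[OF lin] invol)
    qed
  qed
  ultimately show ?thesis
    unfolding conformal_def using lin assms by (metis less_irrefl zero_less_power)
qed

lemma inversion_composition_lift:
  assumes "inversion_composition f D"
  shows "\<exists>T. conformal T \<and> (\<forall>x\<in>D. \<exists>k. k \<noteq> 0 \<and> T (lift x) = k *\<^sub>R lift (f x))"
  using assms
proof induction
  case identity
  then show ?case
    by (intro exI[of _ "\<lambda>z. z"] conjI conformal_id ballI exI[of _ "1::real"]) simp_all
next
  case (inversion f D r c)
  then obtain T where T: "conformal T" "\<And>x. x \<in> D \<Longrightarrow> \<exists>k. k \<noteq> 0 \<and> T (lift x) = k *\<^sub>R lift (f x)"
    by blast
  have lin: "linear (inversion_map c r)"
    using conformal_inversion_map[OF inversion(2)] by (rule conformal_linear)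
  have "\<exists>k. k \<noteq> 0 \<and> inversion_map c r (T (lift x)) = k *\<^sub>R lift (inversion c r (f x))"
    if x: "x \<in> D" "f x \<noteq> c" for x
  proof -
    obtain k where "k \<noteq> 0" "T (lift x) = k *\<^sub>R lift (f x)" using T(2)[OF x(1)] by blast
    then show ?thesis
      using x(2)
      by (intro exI[of _ "k * (norm (f x - c))\<^sup>2"])
        (simp add: linear_scale[OF lin] inversion_map_lift)
  qed
  then show ?case
    using conformal_comp[OF conformal_inversion_map[OF inversion(2)] T(1)]
    by (intro exI[of _ "\<lambda>z. inversion_map c r (T z)"]) auto
qed

lemma inversion_composition_inj_on:
  assumes "inversion_composition f D"
  shows "inj_on f D"
proof (rule inj_onI)
  fix x y assume xy: "x \<in> D" "y \<in> D" "f x = f y"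
  obtain T where T: "conformal T" "\<And>x. x \<in> D \<Longrightarrow> \<exists>k. k \<noteq> 0 \<and> T (lift x) = k *\<^sub>R lift (f x)"
    using inversion_composition_lift[OF assms] by blast
  obtain k l where "k \<noteq> 0" "l \<noteq> 0" "T (lift x) = k *\<^sub>R lift (f x)" "T (lift y) = l *\<^sub>R lift (f x)"
    using T(2) xy by metis
  then have "l *\<^sub>R T (lift x) = k *\<^sub>R T (lift y)" by simp
  then have "T (l *\<^sub>R lift x) = T (k *\<^sub>R lift y)"
    using conformal_linear[OF T(1)] by (simp add: linear_scale)
  then have "l *\<^sub>R lift x = k *\<^sub>R lift y"
    using conformal_bij[OF T(1)] by (simp add: bij_def inj_eq)
  then show "x = y" using \<open>k \<noteq> 0\<close> by (auto simp: lift_def)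
qed

lemma inversion_composition_finite_Compl:
  assumes "inversion_composition f D"
  shows "finite (- D)"
  using assms
proof induction
  case (inversion f D r c)
  have "finite (D \<inter> f -` {c})"
    using inversion_composition_inj_on[OF inversion(1)]
    by (metis finite.emptyI finite_insert finite_vimage_IntI inf_commute)
  moreover have "- {x \<in> D. f x \<noteq> c} \<subseteq> - D \<union> (D \<inter> f -` {c})" by auto
  ultimately show ?case using inversion(3) by (meson finite_UnI finite_subset)
qed simp


section \<open>Zariski closed sets and Moebius equivalence\<close>

lemma zariski_closed_zero_set:
  "real_polynomial_function p \<Longrightarrow> zariski_closed {x. p x = 0}"
  unfolding zariski_closed_def by (intro exI[of _ "{p}"]) auto

lemma zariski_closed_finite:
  assumes "finite S"
  shows "zariski_closed S"
proof -
  have "real_polynomial_function (\<lambda>x. (x - y) \<bullet> b)" for y b :: 'a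
    by (simp add: inner_diff_left)
      (intro real_polynomial_function_diff real_polynomial_function.intros(1) real_polynomial_function.intros(2)
        bounded_linear_inner_left)
  then have "real_polynomial_function (\<lambda>x. \<Sum>b\<in>Basis. ((x - y) \<bullet> b) * ((x - y) \<bullet> b))" for y :: 'a
    by (intro real_polynomial_function_sum real_polynomial_function.intros(4)) auto
  then have "real_polynomial_function (\<lambda>x. (x - y) \<bullet> (x - y))" for y :: 'a
    by (subst euclidean_inner)
  then have "real_polynomial_function (\<lambda>x. \<Prod>y\<in>S. (x - y) \<bullet> (x - y))"
    using assms by auto
  from zariski_closed_zero_set[OF this] show ?thesis using assms by simp
qed

lemma zariski_closure_zero:
  assumes "real_polynomial_function p" "\<And>x. x \<in> S \<Longrightarrow> p x = 0" "x \<in> zariski_closure S"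
  shows "p x = 0"
  using hull_minimal[of S "{x. p x = 0}" zariski_closed] zariski_closed_zero_set assms by blast

text \<open>
  In a chain of three irreducible sets, the middle one lies in the zeros of a polynomial that does not
  vanish on the largest one. So it is finite, and a finite irreducible set is a single point, which
  leaves no room for the smallest one.
\<close>

lemma zariski_dim_neq_2_if_finite_zeros:
  fixes Z :: "'a::euclidean_space set"
  assumes Z: "\<And>p x. real_polynomial_function p \<Longrightarrow> x \<in> Z \<Longrightarrow> p x \<noteq> 0 \<Longrightarrow> finite {y \<in> Z. p y = 0}"
  shows "zariski_dim Z \<noteq> 2"
proof
  define D where "D = {enat n | n. \<exists>C :: nat \<Rightarrow> 'a set.
     (\<forall>i\<le>n. zariski_closed (C i) \<and> zariski_irreducible (C i) \<and> C i \<subseteq> Z) \<and>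
     (\<forall>i<n. C i \<subset> C (Suc i))}"
  assume "zariski_dim Z = 2"
  then have "Sup D = 2" by (simp add: zariski_dim_def D_def)
  have "\<exists>d\<in>D. \<not> d \<le> 1"
  proof (rule ccontr)
    assume "\<not> (\<exists>d\<in>D. \<not> d \<le> 1)"
    then have "Sup D \<le> 1" by (intro Sup_least) blast
    then show False using \<open>Sup D = 2\<close> by (simp add: numeral_eq_enat one_enat_def)
  qed
  then obtain n C where n: "\<not> enat n \<le> 1"
    and C: "\<And>i. i \<le> n \<Longrightarrow> zariski_closed (C i) \<and> zariski_irreducible (C i) \<and> C i \<subseteq> Z"
      "\<And>i. i < n \<Longrightarrow> C i \<subset> C (Suc i)"
    unfolding D_def by blast
  have "2 \<le> n" using n by (simp add: one_enat_def)
  then have C0: "zariski_irreducible (C 0)" and C1: "zariski_closed (C 1)" "zariski_irreducible (C 1)"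
    and C2: "C 2 \<subseteq> Z" and C01: "C 0 \<subset> C 1" and C12: "C 1 \<subset> C 2"
    using C(1)[of 0] C(1)[of 1] C(1)[of 2] C(2)[of 0] C(2)[of 1] by (auto simp: numeral_2_eq_2)
  obtain x where x: "x \<in> C 2" "x \<notin> C 1" using C12 by blast
  then obtain p where p: "real_polynomial_function p" "p x \<noteq> 0" "\<And>y. y \<in> C 1 \<Longrightarrow> p y = 0"
    using C1(1) unfolding zariski_closed_def by blast
  have "finite {y \<in> Z. p y = 0}" using Z p x C2 by blast
  moreover have "C 1 \<subseteq> {y \<in> Z. p y = 0}" using p(3) C12 C2 by blast
  ultimately have fin: "finite (C 1)" by (rule rev_finite_subset)
  obtain y where "y \<in> C 0" using C0 by (auto simp: zariski_irreducible_def)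
  then have "C 1 \<subseteq> {y} \<union> (C 1 - {y})" "y \<in> C 1" using C01 by auto
  then have "C 1 \<subseteq> {y}"
    using C1(2) zariski_closed_finite[of "{y}"] zariski_closed_finite[of "C 1 - {y}"] fin
    unfolding zariski_irreducible_def by blast
  then show False using C01 \<open>y \<in> C 0\<close> by blast
qed

lemma surface_infinite: "surface Z \<Longrightarrow> infinite Z"
  using zariski_dim_neq_2_if_finite_zeros[of Z] by (auto simp: surface_def)

lemma real_polynomial_function_lift:
  assumes "linear \<phi>"
  shows "real_polynomial_function (\<lambda>x::'a::euclidean_space. \<phi> (lift x))"
proof -
  have l: "lift x = (x, 0, 0) + 1 *\<^sub>R (0, 1, 0) + (x \<bullet> x) *\<^sub>R (0, 0, 1)" for x :: 'a
    by (simp add: lift_def)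
  then have eq: "\<phi> (lift x) = \<phi> (x, 0, 0) + \<phi> (0, 1, 0) + (x \<bullet> x) * \<phi> (0, 0, 1)" for x
    unfolding l linear_add[OF assms] linear_scale[OF assms] by simp
  have "linear (\<lambda>x. \<phi> (x, 0, 0))"
  proof (rule linearI)
    fix x y :: 'a and r :: real
    show "\<phi> (x + y, 0, 0) = \<phi> (x, 0, 0) + \<phi> (y, 0, 0)"
      using linear_add[OF assms, of "(x, 0, 0)" "(y, 0, 0)"] by simp
    show "\<phi> (r *\<^sub>R x, 0, 0) = r *\<^sub>R \<phi> (x, 0, 0)"
      using linear_scale[OF assms, of r "(x, 0, 0)"] by simp
  qed
  then have "real_polynomial_function (\<lambda>x. \<phi> (x, 0, 0))"
    by (simp add: linear_conv_bounded_linear real_polynomial_function.intros(1))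
  moreover have "real_polynomial_function (\<lambda>x::'a. x \<bullet> x)"
  proof (subst euclidean_inner)
    show "real_polynomial_function (\<lambda>x::'a. \<Sum>b\<in>Basis. (x \<bullet> b) * (x \<bullet> b))"
      by (intro real_polynomial_function_sum real_polynomial_function.intros(4)
          real_polynomial_function.intros(1) bounded_linear_inner_left) auto
  qed
  ultimately show ?thesis
    unfolding eq by (intro real_polynomial_function.intros(3) real_polynomial_function.intros(4)
        real_polynomial_function.intros(2))
qed

lemma real_form_lift_polynomial:
  assumes "real_form n F"
  shows "\<exists>p. real_polynomial_function p \<and> (\<forall>x. F (lift x, 0) = of_real (p x))"
  using assms
proof induction
  case (const c)
  show ?case by (intro exI[of _ "\<lambda>x. c"]) (auto intro: real_polynomial_function.intros(2))
next
  case (linear \<phi>)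
  then show ?case
    by (intro exI[of _ "\<lambda>x. \<phi> (lift x)"]) (simp add: cx_real real_polynomial_function_lift)
next
  case (add n F G)
  then obtain p q where "real_polynomial_function p" "real_polynomial_function q"
    "\<forall>x. F (lift x, 0) = of_real (p x)" "\<forall>x. G (lift x, 0) = of_real (q x)" by blast
  then show ?case by (intro exI[of _ "\<lambda>x. p x + q x"]) (auto intro: real_polynomial_function.intros(3))
next
  case (mult n F m G)
  then obtain p q where "real_polynomial_function p" "real_polynomial_function q"
    "\<forall>x. F (lift x, 0) = of_real (p x)" "\<forall>x. G (lift x, 0) = of_real (q x)" by blast
  then show ?case by (intro exI[of _ "\<lambda>x. p x * q x"]) (auto intro: real_polynomial_function.intros(4))
qed

text \<open>
  Stated for a form \<open>F\<close> on the complexified space and real points, which are the pairs with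
  imaginary part 0.
\<close>

definition vanishes_on :: "(('a::euclidean_space \<times> real \<times> real) \<times> ('a \<times> real \<times> real) \<Rightarrow> complex) \<Rightarrow> 'a set \<Rightarrow> bool" where
  "vanishes_on F S \<longleftrightarrow> (\<forall>x\<in>S. F (lift x, 0) = 0)"

lemma vanishes_on_closure:
  assumes "real_form n F" "vanishes_on F S"
  shows "vanishes_on F (zariski_closure S)"
proof -
  obtain p where "real_polynomial_function p" "\<And>x. F (lift x, 0) = of_real (p x)"
    using real_form_lift_polynomial[OF assms(1)] by blast
  then show ?thesis
    using assms(2) zariski_closure_zero[of p S] by (simp add: vanishes_on_def)
qed

text \<open>
  A surface is irreducible and infinite, so finitely many of its points, here the points that are
  moved to infinity, do not affect its equations.
\<close>

lemma vanishes_on_surface: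
  assumes F: "real_form n F" "vanishes_on F (Z \<inter> D)" and Z: "surface Z" and D: "finite (- D)"
  shows "vanishes_on F Z"
proof -
  obtain p where p: "real_polynomial_function p" "\<And>x. F (lift x, 0) = of_real (p x)"
    using real_form_lift_polynomial[OF F(1)] by blast
  have "Z \<subseteq> {x. p x = 0} \<union> - D"
    using F(2) p(2) by (auto simp: vanishes_on_def)
  moreover have "\<not> Z \<subseteq> - D"
    using D surface_infinite[OF Z] finite_subset by blast
  ultimately have "Z \<subseteq> {x. p x = 0}"
    using Z zariski_closed_finite[OF D] zariski_closed_zero_set[OF p(1)]
    unfolding surface_def zariski_irreducible_def by blast
  then show ?thesis using p(2) by (auto simp: vanishes_on_def)
qed

lemma vanishes_on_moebius_maps_to:
  assumes maps: "moebius_maps_to Z W" and Z: "surface Z"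
  shows "\<exists>T. conformal T \<and>
    (\<forall>n F. real_form n F \<longrightarrow> vanishes_on F W \<longleftrightarrow> vanishes_on (\<lambda>z. F (map_prod T T z)) Z)"
proof -
  obtain f D where f: "inversion_composition f D" "W = zariski_closure (f ` (Z \<inter> D))"
    using maps unfolding moebius_maps_to_def by blast
  obtain T where T: "conformal T" "\<And>x. x \<in> D \<Longrightarrow> \<exists>k. k \<noteq> 0 \<and> T (lift x) = k *\<^sub>R lift (f x)"
    using inversion_composition_lift[OF f(1)] by blast
  have lin: "linear T" using T(1) by (rule conformal_linear)
  have "vanishes_on F W \<longleftrightarrow> vanishes_on (\<lambda>z. F (map_prod T T z)) Z" if F: "real_form n F" for n F
  proof -
    have eq: "F (map_prod T T (lift x, 0)) = 0 \<longleftrightarrow> F (lift (f x), 0) = 0" if x: "x \<in> D" for x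
    proof -
      obtain k where "k \<noteq> 0" "T (lift x) = k *\<^sub>R lift (f x)" using T(2)[OF x] by blast
      then show ?thesis by (simp add: linear_0[OF lin] real_form_scaleR[OF F])
    qed
    have "vanishes_on F W \<longleftrightarrow> vanishes_on F (f ` (Z \<inter> D))"
      unfolding f(2)
      using vanishes_on_closure[OF F] hull_subset[of "f ` (Z \<inter> D)" zariski_closed]
      by (meson subsetD vanishes_on_def)
    also have "\<dots> \<longleftrightarrow> vanishes_on (\<lambda>z. F (map_prod T T z)) (Z \<inter> D)"
      using eq by (auto simp: vanishes_on_def)
    also have "\<dots> \<longleftrightarrow> vanishes_on (\<lambda>z. F (map_prod T T z)) Z"
      using vanishes_on_surface[OF real_form_comp[OF F lin] _ Z inversion_composition_finite_Compl[OF f(1)]]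
      by (auto simp: vanishes_on_def)
    finally show ?thesis .
  qed
  then show ?thesis using T(1) by blast
qed

text \<open>
  Lifts of Moebius maps are invertible, so an equation can be pulled back along a map from \<open>W\<close> to \<open>Z\<close>
  as well as pushed forward along a map from \<open>Z\<close> to \<open>W\<close>.
\<close>

lemma moebius_equivalent_transfer:
  assumes "moebius_equivalent Z W" "surface Z" "surface W"
    and F: "real_form n F" "vanishes_on F Z"
  obtains T where "conformal T" "vanishes_on (\<lambda>z. F (map_prod T T z)) W"
  using assms(1) unfolding moebius_equivalent_def
proof
  assume *: "moebius_maps_to W Z"
  obtain T where T: "conformal T"
    "\<And>n F. real_form n F \<Longrightarrow> vanishes_on F Z \<longleftrightarrow> vanishes_on (\<lambda>z. F (map_prod T T z)) W"
    using vanishes_on_moebius_maps_to[OF * assms(3)] by blast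
  show ?thesis using that[OF T(1)] T(2)[OF F(1)] F(2) by simp
next
  assume *: "moebius_maps_to Z W"
  obtain T where T: "conformal T"
    "\<And>n F. real_form n F \<Longrightarrow> vanishes_on F W \<longleftrightarrow> vanishes_on (\<lambda>z. F (map_prod T T z)) Z"
    using vanishes_on_moebius_maps_to[OF * assms(2)] by blast
  define S where "S = inv T"
  have S: "conformal S" using conformal_inv[OF T(1)] by (simp add: S_def)
  have "S (T z) = z" for z
    using conformal_bij[OF T(1)] by (simp add: S_def bij_def)
  then have ST: "map_prod S S (map_prod T T z) = z" for z by (simp add: prod_eq_iff)
  have "real_form n (\<lambda>z. F (map_prod S S z))"
    using real_form_comp[OF F(1) conformal_linear[OF S]] .
  from T(2)[OF this] have "vanishes_on (\<lambda>z. F (map_prod S S z)) W"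
    using F(2) by (simp only: ST)
  then show ?thesis by (rule that[OF S])
qed

section \<open>Circles\<close>

lemma circle_frame:
  fixes S :: "'a::euclidean_space set"
  assumes S: "subspace S" "dim S = 2" and g: "g \<in> S" "norm g = 1"
  obtains e where "e \<in> S" "norm e = 1" "e \<bullet> g = 0"
    "\<And>w r. r > 0 \<Longrightarrow> w \<in> S \<and> norm w = r \<longleftrightarrow>
      (\<exists>\<theta>. w = cos \<theta> *\<^sub>R (r *\<^sub>R e) + sin \<theta> *\<^sub>R (r *\<^sub>R g))"
proof -
  have "\<not> S \<subseteq> span {g}"
  proof
    assume "S \<subseteq> span {g}"
    then have "dim S \<le> card {g}" by (intro dim_le_card) auto
    then show False using S(2) by simp
  qed
  then obtain w where w: "w \<in> S" "w \<notin> span {g}" by blast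
  define e0 where "e0 = w - (w \<bullet> g) *\<^sub>R g"
  define e where "e = e0 /\<^sub>R norm e0"
  have gg: "g \<bullet> g = 1" using g(2) by (simp add: norm_eq_1)
  have "e0 \<noteq> 0" using w(2) by (auto simp: e0_def span_singleton)
  have eS: "e \<in> S" using S(1) w(1) g(1) by (simp add: e_def e0_def subspace_diff subspace_scale)
  have en: "norm e = 1" using \<open>e0 \<noteq> 0\<close> by (simp add: e_def)
  have eg: "e \<bullet> g = 0" by (simp add: e_def e0_def inner_diff_left gg)
  have ee: "e \<bullet> e = 1" using en by (simp add: norm_eq_1)
  have ge: "g \<bullet> e = 0" using eg by (simp add: inner_commute)
  have "independent {e, g}"
    using eg gg ee by (intro pairwise_orthogonal_independent)
      (auto simp: pairwise_def orthogonal_def inner_commute)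
  moreover have "e \<noteq> g" using eg ee by auto
  then have "card {e, g} = 2" by simp
  ultimately have "S \<subseteq> span {e, g}"
    using eS g(1) S(2) by (intro card_ge_dim_independent) auto
  then have expand: "w = (w \<bullet> e) *\<^sub>R e + (w \<bullet> g) *\<^sub>R g" if wS: "w \<in> S" for w
  proof -
    obtain a b where "w = a *\<^sub>R e + b *\<^sub>R g"
      using wS \<open>S \<subseteq> span {e, g}\<close> by (auto simp: span_insert span_singleton algebra_simps)
    then show ?thesis by (simp add: inner_add_left eg ge ee gg)
  qed
  have "w \<in> S \<and> norm w = r \<longleftrightarrow> (\<exists>\<theta>. w = cos \<theta> *\<^sub>R (r *\<^sub>R e) + sin \<theta> *\<^sub>R (r *\<^sub>R g))"
    if r: "r > 0" for w r
  proof
    assume w: "w \<in> S \<and> norm w = r"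
    have "(a *\<^sub>R e + b *\<^sub>R g) \<bullet> (a *\<^sub>R e + b *\<^sub>R g) = a\<^sup>2 + b\<^sup>2" for a b
      by (simp add: inner_add_left inner_add_right ee gg eg ge power2_eq_square)
    then have "w \<bullet> w = (w \<bullet> e)\<^sup>2 + (w \<bullet> g)\<^sup>2"
      using expand w by metis
    then have "(w \<bullet> e)\<^sup>2 + (w \<bullet> g)\<^sup>2 = r\<^sup>2" using w by (simp add: dot_square_norm)
    then have "(w \<bullet> e / r)\<^sup>2 + (w \<bullet> g / r)\<^sup>2 = 1" using r by (simp add: power_divide field_simps)
    then obtain \<theta> where "w \<bullet> e / r = cos \<theta>" "w \<bullet> g / r = sin \<theta>"
      by (rule sincos_total_2pi) blast
    then have "w \<bullet> e = cos \<theta> * r" "w \<bullet> g = sin \<theta> * r" using r by (simp_all add: field_simps)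
    moreover have "w = (w \<bullet> e) *\<^sub>R e + (w \<bullet> g) *\<^sub>R g" using expand w by blast
    ultimately show "\<exists>\<theta>. w = cos \<theta> *\<^sub>R (r *\<^sub>R e) + sin \<theta> *\<^sub>R (r *\<^sub>R g)"
      by (metis scaleR_scaleR)
  next
    assume "\<exists>\<theta>. w = cos \<theta> *\<^sub>R (r *\<^sub>R e) + sin \<theta> *\<^sub>R (r *\<^sub>R g)"
    then obtain \<theta> where w: "w = cos \<theta> *\<^sub>R (r *\<^sub>R e) + sin \<theta> *\<^sub>R (r *\<^sub>R g)" by blast
    have "w \<bullet> w = r * r * (cos \<theta> * cos \<theta>) + r * r * (sin \<theta> * sin \<theta>)"
      unfolding w by (simp add: inner_add_left inner_add_right ee gg eg ge algebra_simps)
    also have "\<dots> = r\<^sup>2" by (simp add: power2_eq_square flip: distrib_left)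
    finally have "w \<bullet> w = r\<^sup>2" .
    then have "norm w = r" using r by (simp add: norm_eq_sqrt_inner)
    then show "w \<in> S \<and> norm w = r"
      unfolding w using S(1) eS g(1) by (simp add: subspace_add subspace_scale)
  qed
  then show ?thesis using that eS en eg by blast
qed

lemma circle_subspace:
  fixes C :: "'a::euclidean_space set"
  assumes "circle C"
  obtains c S r where "subspace S" "dim S = 2" "r > 0" "\<And>x. x \<in> C \<longleftrightarrow> x - c \<in> S \<and> norm (x - c) = r"
proof -
  obtain P c r where P: "affine P" "aff_dim P = 2" "c \<in> P" "r > 0" "C = P \<inter> sphere c r"
    using assms unfolding circle_def by blast
  define S where "S = (+) (- c) ` P"
  have S: "subspace S" using affine_diffs_subspace[OF P(1,3)] by (simp add: S_def)
  moreover have "aff_dim S = 2" unfolding S_def aff_dim_translation_eq by (rule P(2))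
  then have "dim S = 2" using aff_dim_subspace[OF S] by simp
  moreover have "x \<in> C \<longleftrightarrow> x - c \<in> S \<and> norm (x - c) = r" for x
    by (auto simp: P(5) S_def dist_norm norm_minus_commute image_iff algebra_simps)
  ultimately show ?thesis using that P(4) by blast
qed

lemma unit_vector_in_subspace:
  fixes S :: "'a::euclidean_space set"
  assumes "subspace S" "dim S > 0"
  obtains g where "g \<in> S" "norm g = 1"
proof -
  have "\<not> S \<subseteq> {0}" using assms(2) by (metis dim_eq_0 less_irrefl)
  then obtain x where "x \<in> S" "x \<noteq> 0" by blast
  then show ?thesis
    using that[of "x /\<^sub>R norm x"] assms(1) by (simp add: subspace_scale)
qed

lemma circle_parametrization:
  fixes C :: "'a::euclidean_space set"
  assumes "circle C"
  obtains c e f where "norm e = norm f" "e \<noteq> 0" "e \<bullet> f = 0"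
    "C = range (\<lambda>\<theta>. c + cos \<theta> *\<^sub>R e + sin \<theta> *\<^sub>R f)"
proof -
  obtain c S r where S: "subspace S" "dim S = 2" "r > 0"
    "\<And>x. x \<in> C \<longleftrightarrow> x - c \<in> S \<and> norm (x - c) = r"
    using circle_subspace[OF assms] by metis
  obtain g where g: "g \<in> S" "norm g = 1" using unit_vector_in_subspace[OF S(1)] S(2) by auto
  obtain e where e: "e \<in> S" "norm e = 1" "e \<bullet> g = 0"
    "\<And>w r. r > 0 \<Longrightarrow> w \<in> S \<and> norm w = r \<longleftrightarrow>
      (\<exists>\<theta>. w = cos \<theta> *\<^sub>R (r *\<^sub>R e) + sin \<theta> *\<^sub>R (r *\<^sub>R g))"
    using circle_frame[OF S(1,2) g] by metis
  have "x \<in> C \<longleftrightarrow> (\<exists>\<theta>. x = c + cos \<theta> *\<^sub>R (r *\<^sub>R e) + sin \<theta> *\<^sub>R (r *\<^sub>R g))" for x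
    unfolding S(4) e(4)[OF S(3)] by (simp add: algebra_simps)
  then have "C = range (\<lambda>\<theta>. c + cos \<theta> *\<^sub>R (r *\<^sub>R e) + sin \<theta> *\<^sub>R (r *\<^sub>R g))"
    by blast
  moreover have "norm (r *\<^sub>R e) = norm (r *\<^sub>R g)" "r *\<^sub>R e \<noteq> 0" "(r *\<^sub>R e) \<bullet> (r *\<^sub>R g) = 0"
    using e g(2) S(3) by auto
  ultimately show ?thesis using that by blast
qed

section \<open>Quaternions\<close>

definition qcnj :: "real ^ 4 \<Rightarrow> real ^ 4" where
  "qcnj a = vector [a $ 1, - a $ 2, - a $ 3, - a $ 4]"

lemma vector_4 [simp]:
  "(vector [x, y, z, w] :: 'a::zero ^ 4) $ 1 = x"
  "(vector [x, y, z, w] :: 'a::zero ^ 4) $ 2 = y"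
  "(vector [x, y, z, w] :: 'a::zero ^ 4) $ 3 = z"
  "(vector [x, y, z, w] :: 'a::zero ^ 4) $ 4 = w"
  unfolding vector_def by simp_all

lemmas quaternion_defs = vec_eq_iff forall_4 hamilton_def qcnj_def inner_vec_def sum_4

lemma hamilton_assoc: "(a \<star> b) \<star> c = a \<star> (b \<star> c)"
  by (simp add: quaternion_defs algebra_simps)

lemma linear_hamilton_left: "linear (\<lambda>a. a \<star> b)"
  and linear_hamilton_right: "linear (\<lambda>b. a \<star> b)"
  by (rule linearI; simp add: quaternion_defs algebra_simps)+

lemmas hamilton_linear =
  linear_add[OF linear_hamilton_left] linear_diff[OF linear_hamilton_left]
  linear_scale[OF linear_hamilton_left] linear_neg[OF linear_hamilton_left] linear_0[OF linear_hamilton_left]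
  linear_add[OF linear_hamilton_right] linear_diff[OF linear_hamilton_right]
  linear_scale[OF linear_hamilton_right] linear_neg[OF linear_hamilton_right] linear_0[OF linear_hamilton_right]

lemma linear_qcnj: "linear qcnj"
  by (rule linearI; simp add: quaternion_defs)

lemma qcnj_qcnj [simp]: "qcnj (qcnj a) = a"
  by (simp add: quaternion_defs)

lemma qcnj_hamilton: "qcnj (a \<star> b) = qcnj b \<star> qcnj a"
  by (simp add: quaternion_defs algebra_simps)

lemma inner_qcnj [simp]: "qcnj a \<bullet> qcnj b = a \<bullet> b"
  by (simp add: quaternion_defs)

lemma norm_qcnj [simp]: "norm (qcnj a) = norm a"
  by (simp add: norm_eq_sqrt_inner)

lemma inner_hamilton_left: "(a \<star> b) \<bullet> (a \<star> c) = (a \<bullet> a) * (b \<bullet> c)"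
  by (simp add: quaternion_defs algebra_simps)

lemma inner_hamilton_right: "(a \<star> c) \<bullet> (b \<star> c) = (a \<bullet> b) * (c \<bullet> c)"
  by (simp add: quaternion_defs algebra_simps)

lemma norm_hamilton: "norm (a \<star> b) = norm a * norm b"
  by (simp add: norm_eq_sqrt_inner inner_hamilton_left real_sqrt_mult)

lemma hamilton_eq_0_iff [simp]: "a \<star> b = 0 \<longleftrightarrow> a = 0 \<or> b = 0"
  by (metis norm_hamilton mult_eq_0_iff norm_eq_zero)

lemma hamilton_qcnj_cancel: "a \<star> (qcnj a \<star> b) = (a \<bullet> a) *\<^sub>R b"
  by (simp add: quaternion_defs algebra_simps)

text \<open>
  For orthogonal \<open>e\<close> and \<open>f\<close> of the same norm, \<open>j = e\<inverse> f\<close> is an imaginary unit, so \<open>f = e j\<close> and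
  \<open>e = - f j\<close>. Thus left multiplication by \<open>j\<close> is the multiplication by \<open>\<i>\<close> on the complex vectors
  \<open>(e - \<i> f) h\<close>.
\<close>

definition left_quotient :: "real ^ 4 \<Rightarrow> real ^ 4 \<Rightarrow> real ^ 4" where
  "left_quotient e f = (qcnj e \<star> f) /\<^sub>R (e \<bullet> e)"

lemma left_quotient:
  assumes "norm e = norm f" "e \<noteq> 0" "e \<bullet> f = 0"
  defines "j \<equiv> left_quotient e f"
  shows "e \<star> (j \<star> h) = f \<star> h" "f \<star> (j \<star> h) = - (e \<star> h)" "j \<star> (j \<star> h) = - h" "norm j = 1"
proof -
  have ee: "e \<bullet> e \<noteq> 0" using assms(2) by simp
  have ff: "f \<bullet> f = e \<bullet> e" using assms(1) by (simp add: norm_eq)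
  have sc: "j \<star> x = (1 / (e \<bullet> e)) *\<^sub>R ((qcnj e \<star> f) \<star> x)" for x
    by (simp add: j_def left_quotient_def hamilton_linear divide_inverse)
  show 1: "e \<star> (j \<star> h) = f \<star> h" for h
    using ee by (simp add: sc hamilton_linear hamilton_assoc hamilton_qcnj_cancel)
  have anti: "qcnj e \<star> f = - (qcnj f \<star> e)"
    using assms(3) by (simp add: quaternion_defs algebra_simps)
  have "f \<star> (j \<star> h) = (1 / (e \<bullet> e)) *\<^sub>R (f \<star> (- (qcnj f \<star> e) \<star> h))"
    by (simp add: sc hamilton_linear anti)
  also have "\<dots> = - (e \<star> h)"
    using ee by (simp add: hamilton_linear hamilton_assoc hamilton_qcnj_cancel ff)
  finally show 2: "f \<star> (j \<star> h) = - (e \<star> h)" .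
  have "e \<star> (j \<star> (j \<star> h)) = e \<star> (- h)"
    by (simp add: 1 2 hamilton_linear)
  then have "e \<star> (j \<star> (j \<star> h) - (- h)) = 0" by (simp only: hamilton_linear) simp
  then show "j \<star> (j \<star> h) = - h" using assms(2) by (simp add: eq_neg_iff_add_eq_0)
  have "norm f \<noteq> 0" using assms(1,2) by (metis norm_eq_zero)
  then show "norm j = 1"
    using assms(1) by (simp add: j_def left_quotient_def norm_hamilton dot_square_norm power2_eq_square field_simps)
qed

lemma qcnj_left_quotient:
  assumes "e \<bullet> f = 0"
  shows "qcnj (left_quotient e f) = - left_quotient e f"
proof -
  have "qcnj (qcnj e \<star> f) = - (qcnj e \<star> f)"
    using assms by (simp add: quaternion_defs algebra_simps)
  then show ?thesis by (simp add: left_quotient_def linear_scale[OF linear_qcnj])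
qed

lemma inner_hamilton_imaginary:
  assumes "qcnj j = - j"
  shows "x \<bullet> (j \<star> x) = 0"
proof -
  have "j $ 1 = 0" using assms by (simp add: quaternion_defs)
  then show ?thesis by (simp add: quaternion_defs algebra_simps)
qed

text \<open>Multiplication of quaternions by complex scalars, with \<open>j\<close> in the role of \<open>\<i>\<close>.\<close>

definition qact :: "real ^ 4 \<Rightarrow> complex \<Rightarrow> real ^ 4 \<Rightarrow> real ^ 4" where
  "qact j s h = Re s *\<^sub>R h + Im s *\<^sub>R (j \<star> h)"

lemma qact_qact:
  assumes "\<And>h. j \<star> (j \<star> h) = - h"
  shows "qact j s (qact j t h) = qact j (s * t) h"
  using assms by (simp add: qact_def hamilton_linear algebra_simps)

lemma linear_qact: "linear (qact j s)"
  by (rule linearI) (simp_all add: qact_def hamilton_linear algebra_simps)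

lemma qact_0 [simp]: "qact j 0 h = 0" and qact_1 [simp]: "qact j 1 h = h"
  by (simp_all add: qact_def)

section \<open>Null lines of Cliffordian surfaces\<close>

text \<open>
  The linear map \<open>K\<close> sends homogeneous coordinates \<open>(y, s)\<close> of \<open>S\<^sup>3\<close> to the light cone. The
  definition leaves it free up to conformal maps, which absorbs the Moebius equivalence, and up to
  isometries of \<open>S\<^sup>3\<close>, which allows exchanging the two factors by quaternion conjugation.
\<close>

definition sphere_chart :: "((real ^ 4) \<times> real \<Rightarrow> 'a::euclidean_space \<times> real \<times> real) \<Rightarrow> bool" where
  "sphere_chart K \<longleftrightarrow> linear K \<and> surj K \<and>
    (\<exists>k. k \<noteq> 0 \<and> (\<forall>y s. lorentz (K (y, s)) = k * (y \<bullet> y - s\<^sup>2)))"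

text \<open>The complex vector \<open>K ((e - \<i> f) h, 0)\<close>.\<close>

definition null_vector ::
    "((real ^ 4) \<times> real \<Rightarrow> 'b::real_vector) \<Rightarrow> real ^ 4 \<Rightarrow> real ^ 4 \<Rightarrow> real ^ 4 \<Rightarrow> 'b \<times> 'b" where
  "null_vector K e f h = (K (e \<star> h, 0), - K (f \<star> h, 0))"

lemma linear_chart_slice: "linear K \<Longrightarrow> linear (\<lambda>y. K (y, 0))"
  by (rule linearI) (simp_all flip: linear_add linear_scale)

lemma null_vector_add:
  assumes "linear K"
  shows "null_vector K e f (g + h) = null_vector K e f g + null_vector K e f h"
  using linear_add[OF linear_chart_slice[OF assms]]
  by (simp add: null_vector_def hamilton_linear)

lemma null_vector_qact:
  assumes "linear K" "norm e = norm f" "e \<noteq> 0" "e \<bullet> f = 0"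
  shows "null_vector K e f (qact (left_quotient e f) s h) = cscale s (null_vector K e f h)"
  by (simp add: null_vector_def qact_def cscale_def hamilton_linear left_quotient(1,2)[OF assms(2-4)]
      linear_add[OF linear_chart_slice[OF assms(1)]] linear_diff[OF linear_chart_slice[OF assms(1)]]
      linear_scale[OF linear_chart_slice[OF assms(1)]])

lemma ellipse_inj:
  fixes e f :: "'a::real_inner"
  assumes "e \<noteq> 0" "norm e = norm f" "e \<bullet> f = 0"
    and "\<alpha> \<in> {0..<2 * pi}" "\<beta> \<in> {0..<2 * pi}"
    and eq: "c + cos \<alpha> *\<^sub>R e + sin \<alpha> *\<^sub>R f = c + cos \<beta> *\<^sub>R e + sin \<beta> *\<^sub>R f"
  shows "\<alpha> = \<beta>"
proof -
  have "f \<noteq> 0" using assms(1,2) by auto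
  have "(cos \<alpha> *\<^sub>R e + sin \<alpha> *\<^sub>R f) \<bullet> e = (cos \<beta> *\<^sub>R e + sin \<beta> *\<^sub>R f) \<bullet> e"
    "(cos \<alpha> *\<^sub>R e + sin \<alpha> *\<^sub>R f) \<bullet> f = (cos \<beta> *\<^sub>R e + sin \<beta> *\<^sub>R f) \<bullet> f"
    using eq by simp_all
  then have "cis \<alpha> = cis \<beta>"
    using assms(1,3) \<open>f \<noteq> 0\<close> by (simp add: inner_add_left inner_add_right inner_commute complex_eq_iff)
  then show ?thesis using inj_on_cis assms(4,5) by (simp add: inj_on_eq_iff)
qed

text \<open>
  The null vector is the leading coefficient of the circle \<open>\<theta> \<mapsto> a(\<theta>) \<star> b\<close>, seen as a curve in
  \<open>cis \<theta>\<close>. The exceptional point \<open>q\<close> stands for the north pole, which the stereographic projection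
  omits; the circle passes at most once through it.
\<close>

lemma vanishes_at_null_vector:
  assumes K: "linear K" and F: "real_form n F"
    and ef: "norm e = norm f" "e \<noteq> 0" "e \<bullet> f = 0" and "b \<noteq> 0"
    and zero: "\<And>\<theta>. (c + cos \<theta> *\<^sub>R e + sin \<theta> *\<^sub>R f) \<star> b \<noteq> q \<Longrightarrow>
      F (K ((c + cos \<theta> *\<^sub>R e + sin \<theta> *\<^sub>R f) \<star> b, 1), 0) = 0"
  shows "F (null_vector K e f b) = 0"
proof -
  define a where "a \<theta> = c + cos \<theta> *\<^sub>R e + sin \<theta> *\<^sub>R f" for \<theta>
  have pt: "K (a \<theta> \<star> b, 1) = K (c \<star> b, 1) + cos \<theta> *\<^sub>R K (e \<star> b, 0) + sin \<theta> *\<^sub>R K (f \<star> b, 0)" for \<theta>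
    by (simp add: a_def hamilton_linear linear_scale[OF K, symmetric] linear_add[OF K, symmetric])
  define \<Theta> where "\<Theta> = {\<theta> \<in> {0..<2 * pi}. a \<theta> \<star> b \<noteq> q}"
  have one: "\<alpha> = \<beta>" if "\<alpha> \<in> {0..<2 * pi}" "\<beta> \<in> {0..<2 * pi}" "a \<alpha> \<star> b = q" "a \<beta> \<star> b = q" for \<alpha> \<beta>
  proof -
    have "(a \<alpha> - a \<beta>) \<star> b = 0" using that by (simp add: hamilton_linear)
    then have "a \<alpha> = a \<beta>" using \<open>b \<noteq> 0\<close> by simp
    then show ?thesis using ellipse_inj[OF ef(2,1,3) that(1,2)] by (simp add: a_def)
  qed
  have "finite {\<theta> \<in> {0..<2 * pi}. a \<theta> \<star> b = q}"
  proof (cases "\<exists>\<alpha>\<in>{0..<2 * pi}. a \<alpha> \<star> b = q")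
    case True
    then obtain \<alpha> where "\<alpha> \<in> {0..<2 * pi}" "a \<alpha> \<star> b = q" by blast
    then have "{\<theta> \<in> {0..<2 * pi}. a \<theta> \<star> b = q} \<subseteq> {\<alpha>}" using one by blast
    then show ?thesis by (rule finite_subset) simp
  next
    case False
    then have "{\<theta> \<in> {0..<2 * pi}. a \<theta> \<star> b = q} = {}" by blast
    then show ?thesis by (simp only: finite.emptyI)
  qed
  then have "infinite ({0..<2 * pi} - {\<theta> \<in> {0..<2 * pi}. a \<theta> \<star> b = q})"
    by (rule Diff_infinite_finite) (simp add: infinite_Ico)
  moreover have "{0..<2 * pi} - {\<theta> \<in> {0..<2 * pi}. a \<theta> \<star> b = q} = \<Theta>"
    by (auto simp: \<Theta>_def)
  ultimately have \<Theta>: "infinite \<Theta>" by (simp only: not_False_eq_True)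
  have "\<Theta> \<subseteq> {0..<2 * pi}" by (auto simp: \<Theta>_def)
  from real_form_on_ellipse(1)[OF F \<Theta> this, of "K (c \<star> b, 1)" "K (e \<star> b, 0)" "K (f \<star> b, 0)"]
  show ?thesis using zero by (simp add: null_vector_def pt[symmetric] \<Theta>_def a_def)
qed

lemma linear_kernel:
  fixes f :: "'a::euclidean_space \<Rightarrow> 'b::euclidean_space"
  assumes "linear f" "DIM('b) < DIM('a)"
  shows "\<exists>x. x \<noteq> 0 \<and> f x = 0"
proof -
  have "\<not> inj f"
  proof
    assume "inj f"
    then have "dim (range f) = DIM('a)" using dim_image_eq[OF assms(1), of UNIV] by simp
    then show False using dim_subset_UNIV[of "range f"] assms(2) by simp
  qed
  then show ?thesis using linear_injective_0[OF assms(1)] by blast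
qed

lemma linear_coordinates:
  fixes L :: "'a::euclidean_space \<Rightarrow> 'b::euclidean_space"
  assumes L: "linear L" "dim (range L) = DIM('b)" and dim: "DIM('a) = DIM('b)"
  shows "\<exists>M. linear M \<and> (\<forall>x. M (L x) = x) \<and> (\<forall>y. L (M y) = y)"
proof -
  have "span (range L) = UNIV" using L(2) dim_eq_full[of "range L"] by simp
  then have "surj L" using linear_subspace_image[OF L(1) subspace_UNIV] by (metis span_eq_iff)
  then obtain M where M: "linear M" "L \<circ> M = id"
    using linear_surjective_right_inverse[OF L(1)] by blast
  have LofM: "L (M y) = y" for y using fun_cong[OF M(2), of y] by simp
  have "inj M" by (rule inj_on_inverseI[of _ L]) (rule LofM)
  then have "dim (range M) = DIM('a)"
    using dim_image_eq[OF M(1), of UNIV] dim by simp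
  then have "span (range M) = UNIV" using dim_eq_full[of "range M"] by simp
  then have "range M = UNIV" using linear_subspace_image[OF M(1) subspace_UNIV] by (metis span_eq_iff)
  have "M (L x) = x" for x
  proof -
    obtain y where "x = M y" using \<open>range M = UNIV\<close> by blast
    then show ?thesis by (simp add: LofM)
  qed
  then show ?thesis using M(1) LofM by blast
qed

text \<open>
  The quaternions are a complex plane under left multiplication by \<open>\<real> + \<real> j\<close>. If two points of \<open>B\<close>
  are independent over \<open>\<real> + \<real> j\<close>, they form a basis, and the null vectors of the points of \<open>B\<close> have
  infinitely many directions in the plane of all \<open>(e - \<i> f) h\<close>.
\<close>

lemma vanishes_on_null_plane:
  fixes K :: "(real ^ 4) \<times> real \<Rightarrow> 'b::real_vector"
  assumes K: "linear K" and F: "real_form n F"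
    and ef: "norm e = norm f" "e \<noteq> 0" "e \<bullet> f = 0"
    and b: "\<And>\<theta>. b \<theta> = c' + cos \<theta> *\<^sub>R e' + sin \<theta> *\<^sub>R f'"
    and zero: "\<And>\<theta>. F (null_vector K e f (b \<theta>)) = 0"
    and indep: "b \<alpha> \<noteq> 0" "\<And>s. b \<beta> \<noteq> qact (left_quotient e f) s (b \<alpha>)"
  shows "F (null_vector K e f h) = 0"
proof -
  define j where "j = left_quotient e f"
  define L where "L st = qact j (fst st) (b \<alpha>) + qact j (snd st) (b \<beta>)" for st
  have jj: "j \<star> (j \<star> h) = - h" for h using left_quotient(3)[OF ef] by (simp add: j_def)
  have L: "linear L"
    by (rule linearI) (simp_all add: L_def qact_def algebra_simps)
  have "inj L"
  proof (subst linear_injective_0[OF L], intro allI impI)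
    fix st assume st: "L st = 0"
    obtain s t where [simp]: "st = (s, t)" by (cases st)
    have eq: "qact j s (b \<alpha>) + qact j t (b \<beta>) = 0" using st by (simp add: L_def)
    have "t = 0"
    proof (rule ccontr)
      assume "t \<noteq> 0"
      have "qact j (inverse t) (qact j s (b \<alpha>) + qact j t (b \<beta>)) = 0"
        by (simp add: eq linear_0[OF linear_qact])
      then have "qact j (inverse t * s) (b \<alpha>) + b \<beta> = 0"
        using \<open>t \<noteq> 0\<close> by (simp add: linear_add[OF linear_qact] qact_qact[OF jj])
      then have "b \<beta> = qact j (- (inverse t * s)) (b \<alpha>)"
        by (simp add: qact_def algebra_simps eq_neg_iff_add_eq_0)
      then show False using indep(2) unfolding j_def by blast
    qed
    moreover have "s = 0"
    proof (rule ccontr)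
      assume "s \<noteq> 0"
      then have "b \<alpha> = qact j (inverse s) (qact j s (b \<alpha>))" by (simp add: qact_qact[OF jj])
      also have "\<dots> = 0" using eq \<open>t = 0\<close> by (simp add: linear_0[OF linear_qact])
      finally show False using indep(1) by simp
    qed
    ultimately show "st = 0" by (simp add: zero_prod_def)
  qed
  then have "dim (range L) = DIM(real ^ 4)"
    using dim_image_eq[OF L, of UNIV] by simp
  moreover have "DIM(complex \<times> complex) = DIM(real ^ 4)" by simp
  ultimately obtain M where M: "linear M" and MofL: "\<And>st. M (L st) = st" and LofM: "\<And>h. L (M h) = h"
    using linear_coordinates[OF L] by blast
  have nv: "null_vector K e f h = cscale (fst (M h)) (null_vector K e f (b \<alpha>))
      + cscale (snd (M h)) (null_vector K e f (b \<beta>))" for h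
    using LofM[of h] null_vector_qact[OF K ef] null_vector_add[OF K] by (metis L_def j_def)
  have Mb: "fst (M (b \<theta>)) = fst (M c') + of_real (cos \<theta>) * fst (M e') + of_real (sin \<theta>) * fst (M f')"
    "snd (M (b \<theta>)) = snd (M c') + of_real (cos \<theta>) * snd (M e') + of_real (sin \<theta>) * snd (M f')" for \<theta>
    by (simp_all add: b linear_add[OF M] linear_scale[OF M] scaleR_conv_of_real[where 'a = complex])
  have "M (b \<alpha>) = (1, 0)" "M (b \<beta>) = (0, 1)"
    using MofL[of "(1, 0)"] MofL[of "(0, 1)"] by (simp_all add: L_def)
  then have ends: "fst (M (b \<alpha>)) = 1" "snd (M (b \<alpha>)) = 0" "fst (M (b \<beta>)) = 0" "snd (M (b \<beta>)) = 1"
    by simp_all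
  have "F (cscale s (null_vector K e f (b \<alpha>)) + cscale t (null_vector K e f (b \<beta>))) = 0" for s t
    by (rule real_form_on_plane[where \<sigma> = "\<lambda>\<theta>. fst (M (b \<theta>))" and \<tau> = "\<lambda>\<theta>. snd (M (b \<theta>))"
          and \<alpha> = \<alpha> and \<beta> = \<beta>, OF F _ Mb ends])
      (simp add: zero flip: nv)
  then show ?thesis unfolding nv[of h] by blast
qed

text \<open>
  The points \<open>z + t w\<close> have \<open>u = 1\<close>, so their \<open>x\<close>-coordinates run through a complex line of Euclidean
  space. The conditions on the real and imaginary parts of the \<open>x\<close>-coordinate \<open>d\<close> of \<open>w\<close> express
  \<open>d \<bullet> d = 0\<close> and \<open>d \<noteq> 0\<close>.
\<close>

definition no_isotropic_line ::
    "(('a::euclidean_space \<times> real \<times> real) \<times> ('a \<times> real \<times> real) \<Rightarrow> complex) \<Rightarrow> bool" where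
  "no_isotropic_line F \<longleftrightarrow>
    (\<forall>z w. cx (fst \<circ> snd) z = 1 \<longrightarrow> cx (fst \<circ> snd) w = 0 \<longrightarrow>
      norm (fst (fst w)) = norm (fst (snd w)) \<longrightarrow> fst (fst w) \<bullet> fst (snd w) = 0 \<longrightarrow>
      fst (fst w) \<noteq> 0 \<longrightarrow> (\<exists>t. F (z + cscale t w) \<noteq> 0))"

text \<open>
  The real vectors \<open>K (y, 0)\<close> with \<open>y \<noteq> 0\<close> are not null. If \<open>u\<close> vanished on all of them, their
  \<open>x\<close>-coordinate would be an injective linear map from \<open>\<real>\<^sup>4\<close> to \<open>\<real>\<^sup>3\<close>; so \<open>u\<close> takes the value 1 on the
  complex plane, which gives \<open>z\<close>. A vector of this plane with \<open>u = 0\<close> gives the direction \<open>w\<close>: its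
  \<open>x\<close>-coordinate is isotropic, since the plane is, and not zero, since its real part is not null.
\<close>

lemma null_plane_contains_isotropic_line:
  fixes K :: "(real ^ 4) \<times> real \<Rightarrow> (real ^ 3) \<times> real \<times> real"
  assumes K: "sphere_chart K"
    and ef: "norm e = norm f" "e \<noteq> 0" "e \<bullet> f = 0"
    and zero: "\<And>h. F (null_vector K e f h) = 0"
  shows "\<not> no_isotropic_line F"
proof
  assume no: "no_isotropic_line F"
  define j where "j = left_quotient e f"
  obtain k where k: "k \<noteq> 0" "\<And>y s. lorentz (K (y, s)) = k * (y \<bullet> y - s\<^sup>2)"
    using K unfolding sphere_chart_def by blast
  have lin: "linear K" using K by (simp only: sphere_chart_def)
  note slice = linear_chart_slice[OF lin]
  define X where "X y = fst (K (y, 0))" for y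
  define u where "u y = fst (snd (K (y, 0)))" for y
  have X: "linear X" and u: "linear u"
    unfolding X_def u_def
    by (auto intro!: linearI simp: linear_add[OF slice] linear_scale[OF slice])
  have norm_X: "X y \<bullet> X y = k * (y \<bullet> y)" if "u y = 0" for y
    using k(2)[of y 0] that by (simp add: lorentz_def X_def u_def)
  have "\<exists>y. u y \<noteq> 0"
  proof (rule ccontr)
    assume "\<not> (\<exists>y. u y \<noteq> 0)"
    moreover obtain y where "y \<noteq> 0" "X y = 0" using linear_kernel[OF X] by auto
    ultimately show False using norm_X[of y] k(1) by simp
  qed
  then obtain y where y: "u y \<noteq> 0" by blast
  define nv where "nv = null_vector K e f"
  have cx_nv: "cx (fst \<circ> snd) (nv h) = Complex (u (e \<star> h)) (- u (f \<star> h))" for h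
    by (simp add: cx_def nv_def null_vector_def u_def)
  have "u (e \<star> (qcnj e \<star> y)) \<noteq> 0"
    using y ef(2) by (simp add: hamilton_qcnj_cancel linear_scale[OF u])
  then have "cx (fst \<circ> snd) (nv (qcnj e \<star> y)) \<noteq> 0"
    by (simp add: cx_nv complex_eq_iff)
  then obtain g where g: "cx (fst \<circ> snd) (nv g) \<noteq> 0" by blast
  have fs: "linear (fst \<circ> snd :: (real ^ 3) \<times> real \<times> real \<Rightarrow> real)"
    by (rule linearI) simp_all
  define z where "z = nv (qact j (inverse (cx (fst \<circ> snd) (nv g))) g)"
  have z: "cx (fst \<circ> snd) z = 1"
    unfolding z_def nv_def j_def null_vector_qact[OF lin ef] cx_cscale[OF fs]
    using g by (simp add: nv_def)
  have "linear (\<lambda>h. (u (e \<star> h), u (f \<star> h)))"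
    by (rule linearI) (simp_all add: hamilton_linear linear_add[OF u] linear_scale[OF u])
  then have "\<exists>h. h \<noteq> 0 \<and> (u (e \<star> h), u (f \<star> h)) = 0"
    by (rule linear_kernel) simp
  then obtain h where h: "h \<noteq> 0" "u (e \<star> h) = 0" "u (f \<star> h) = 0"
    by (auto simp: zero_prod_def)
  have w: "cx (fst \<circ> snd) (nv h) = 0" using h by (simp add: cx_nv complex_eq_iff)
  have ee: "f \<bullet> f = e \<bullet> e" using ef(1) by (simp add: norm_eq)
  have XX: "X (e \<star> h) \<bullet> X (e \<star> h) = k * ((e \<bullet> e) * (h \<bullet> h))"
    "X (f \<star> h) \<bullet> X (f \<star> h) = k * ((e \<bullet> e) * (h \<bullet> h))"
    using norm_X h by (simp_all add: inner_hamilton_right ee)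
  have "X (e \<star> h + f \<star> h) \<bullet> X (e \<star> h + f \<star> h) = k * ((e \<star> h + f \<star> h) \<bullet> (e \<star> h + f \<star> h))"
    by (rule norm_X) (simp add: linear_add[OF u] h)
  moreover have "(e \<star> h + f \<star> h) \<bullet> (e \<star> h + f \<star> h) = 2 * ((e \<bullet> e) * (h \<bullet> h))"
    by (simp add: inner_add_left inner_add_right inner_hamilton_right ee ef(3) inner_commute[of f e])
  moreover have "X (e \<star> h + f \<star> h) \<bullet> X (e \<star> h + f \<star> h) =
      X (e \<star> h) \<bullet> X (e \<star> h) + 2 * (X (e \<star> h) \<bullet> X (f \<star> h)) + X (f \<star> h) \<bullet> X (f \<star> h)"
    by (simp add: linear_add[OF X] inner_add_left inner_add_right inner_commute)
  ultimately have "X (e \<star> h) \<bullet> X (f \<star> h) = 0"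
    using XX by simp
  moreover have "norm (X (e \<star> h)) = norm (X (f \<star> h))" using XX by (simp add: norm_eq_sqrt_inner)
  moreover have "X (e \<star> h) \<noteq> 0" using XX(1) k(1) ef(2) h(1) by auto
  moreover have "fst (fst (nv h)) = X (e \<star> h)" "fst (snd (nv h)) = - X (f \<star> h)"
    by (simp_all add: nv_def null_vector_def X_def)
  ultimately have "\<exists>t. F (z + cscale t (nv h)) \<noteq> 0"
    by (intro no[unfolded no_isotropic_line_def, rule_format, OF z w]) simp_all
  then obtain t where "F (z + cscale t (nv h)) \<noteq> 0" by blast
  moreover have "z + cscale t (nv h) = nv (qact j (inverse (cx (fst \<circ> snd) (nv g))) g + qact j t h)"
    by (simp add: z_def nv_def j_def null_vector_add[OF lin] null_vector_qact[OF lin ef])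
  ultimately show False using zero by (simp add: nv_def)
qed

text \<open>
  If two points of \<open>B\<close> are independent over \<open>\<real> + \<real> j\<close>, then \<open>F\<close> vanishes at \<open>K ((e - \<i> f) h, 0)\<close> for
  all \<open>h\<close>, and these points contain an isotropic line. A linear \<open>F\<close> that vanishes there also vanishes
  at the real and imaginary parts, hence on the hyperplane \<open>s = 0\<close>; so it is a multiple of \<open>s\<close> and
  has no zeros on \<open>S\<^sup>3\<close>.
\<close>

lemma cliffordian_one_sided:
  fixes K :: "(real ^ 4) \<times> real \<Rightarrow> (real ^ 3) \<times> real \<times> real"
  assumes K: "sphere_chart K" and F: "real_form n F"
    and ef: "norm e = norm f" "e \<noteq> 0" "e \<bullet> f = 0"
    and a: "\<And>\<theta>. a \<theta> = c + cos \<theta> *\<^sub>R e + sin \<theta> *\<^sub>R f"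
    and b: "\<And>\<theta>. b \<theta> = c' + cos \<theta> *\<^sub>R e' + sin \<theta> *\<^sub>R f'" and b0: "\<And>\<theta>. b \<theta> \<noteq> 0"
    and zero: "\<And>\<theta> \<phi>. a \<theta> \<star> b \<phi> \<noteq> q \<Longrightarrow> F (K (a \<theta> \<star> b \<phi>, 1), 0) = 0"
    and cases: "no_isotropic_line F \<or> (\<exists>l x. linear l \<and> l x \<noteq> 0 \<and> F = cx l)"
  shows "\<exists>s. b \<beta> = qact (left_quotient e f) s (b \<alpha>)"
proof (rule ccontr)
  assume "\<not> (\<exists>s. b \<beta> = qact (left_quotient e f) s (b \<alpha>))"
  then have indep: "b \<beta> \<noteq> qact (left_quotient e f) s (b \<alpha>)" for s by blast
  have lin: "linear K" using K by (simp only: sphere_chart_def)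
  have "F (null_vector K e f (b \<theta>)) = 0" for \<theta>
    using vanishes_at_null_vector[OF lin F ef b0, where c = c and q = q] zero a by metis
  then have plane: "F (null_vector K e f h) = 0" for h
    using vanishes_on_null_plane[OF lin F ef b _ b0 indep] by blast
  then have "\<not> no_isotropic_line F"
    using null_plane_contains_isotropic_line[OF K ef] by blast
  then obtain l x where l: "linear l" "l x \<noteq> 0" "F = cx l" using cases by blast
  have y0: "l (K (y, 0)) = 0" for y
  proof -
    have "K (e \<star> (qcnj e \<star> y), 0) = (e \<bullet> e) *\<^sub>R K (y, 0)"
      using linear_scale[OF linear_chart_slice[OF lin]] by (simp add: hamilton_qcnj_cancel)
    moreover have "l (K (e \<star> (qcnj e \<star> y), 0)) = 0"
      using plane[of "qcnj e \<star> y"] by (simp add: l(3) null_vector_def cx_def complex_eq_iff)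
    ultimately show ?thesis using ef(2) by (simp add: linear_scale[OF l(1)])
  qed
  have "a 0 \<noteq> a pi"
  proof
    assume "a 0 = a pi"
    then have "2 *\<^sub>R e = 0" by (simp add: a scaleR_2 algebra_simps)
    then show False using ef(2) by simp
  qed
  then have "a 0 \<star> b 0 \<noteq> a pi \<star> b 0"
    using b0[of 0] by (metis eq_iff_diff_eq_0 hamilton_eq_0_iff hamilton_linear(2))
  then obtain \<theta> where "a \<theta> \<star> b 0 \<noteq> q" by metis
  from zero[OF this] have "l (K (a \<theta> \<star> b 0, 1)) = 0"
    by (simp add: l cx_real)
  moreover have split: "K (y, s) = K (y, 0) + s *\<^sub>R K (0, 1)" for y s
    by (simp add: linear_add[OF lin, symmetric] linear_scale[OF lin, symmetric])
  ultimately have "l (K (0, 1)) = 0"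
    using y0 by (metis add_0 linear_add[OF l(1)] scaleR_one)
  then have "l (K p) = 0" for p
    using split[of "fst p" "snd p"] y0 by (simp add: linear_add[OF l(1)] linear_scale[OF l(1)])
  moreover have "surj K" using K by (simp only: sphere_chart_def)
  ultimately show False using l(2) by (metis surjD)
qed

lemma sphere_chart_qcnj:
  assumes "sphere_chart K"
  shows "sphere_chart (\<lambda>p. K (qcnj (fst p), snd p))"
proof -
  have lin: "linear K" and "surj K" using assms by (simp_all only: sphere_chart_def)
  obtain k where "k \<noteq> 0" "\<And>y s. lorentz (K (y, s)) = k * (y \<bullet> y - s\<^sup>2)"
    using assms unfolding sphere_chart_def by blast
  then have "k \<noteq> 0 \<and> (\<forall>y s. lorentz (K (qcnj y, s)) = k * (y \<bullet> y - s\<^sup>2))" by simp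
  moreover have "linear (\<lambda>p. K (qcnj (fst p), snd p))"
    by (rule linearI)
      (simp_all add: linear_add[OF linear_qcnj] linear_scale[OF linear_qcnj]
        linear_add[OF lin, symmetric] linear_scale[OF lin, symmetric])
  moreover have "surj (\<lambda>p. K (qcnj (fst p), snd p))"
  proof (rule surjI)
    fix x
    obtain p where "K p = x" using \<open>surj K\<close> by (metis surjD)
    then show "K (qcnj (fst (qcnj (fst (inv K x)), snd (inv K x))), snd (qcnj (fst (inv K x)), snd (inv K x))) = x"
      using \<open>surj K\<close> by (simp add: surj_f_inv_f)
  qed
  ultimately show ?thesis unfolding sphere_chart_def by auto
qed

text \<open>
  By the previous lemma, applied to \<open>A \<star> B\<close> and to the conjugate product with the factors exchanged,
  \<open>B\<close> is contained in \<open>(\<real> + \<real> j) b\<close> and \<open>A\<close> in \<open>a (\<real> + \<real> j')\<close>. Both circles determine the same imaginary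
  unit up to sign, so \<open>A \<star> B\<close> is contained in the plane \<open>a (\<real> + \<real> j) b\<close>.
\<close>

lemma cliffordian_great_circle:
  fixes K :: "(real ^ 4) \<times> real \<Rightarrow> (real ^ 3) \<times> real \<times> real"
  assumes K: "sphere_chart K" and F: "real_form n F"
    and A: "circle A" "A \<subseteq> sphere 0 1" and B: "circle B" "B \<subseteq> sphere 0 1"
    and zero: "\<And>a b. a \<in> A \<Longrightarrow> b \<in> B \<Longrightarrow> a \<star> b \<noteq> q \<Longrightarrow> F (K (a \<star> b, 1), 0) = 0"
    and cases: "no_isotropic_line F \<or> (\<exists>l x. linear l \<and> l x \<noteq> 0 \<and> F = cx l)"
  obtains v w where "norm v = 1" "norm w = 1" "v \<bullet> w = 0"
    "\<And>a b. a \<in> A \<Longrightarrow> b \<in> B \<Longrightarrow> \<exists>\<theta>. a \<star> b = cos \<theta> *\<^sub>R v + sin \<theta> *\<^sub>R w"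
proof -
  obtain c e f where ef: "norm e = norm f" "e \<noteq> 0" "e \<bullet> f = 0"
    and A_eq: "A = range (\<lambda>\<theta>. c + cos \<theta> *\<^sub>R e + sin \<theta> *\<^sub>R f)"
    by (rule circle_parametrization[OF A(1)])
  obtain c' e' f' where ef': "norm e' = norm f'" "e' \<noteq> 0" "e' \<bullet> f' = 0"
    and B_eq: "B = range (\<lambda>\<theta>. c' + cos \<theta> *\<^sub>R e' + sin \<theta> *\<^sub>R f')"
    by (rule circle_parametrization[OF B(1)])
  define a where "a \<theta> = c + cos \<theta> *\<^sub>R e + sin \<theta> *\<^sub>R f" for \<theta>
  define b where "b \<theta> = c' + cos \<theta> *\<^sub>R e' + sin \<theta> *\<^sub>R f'" for \<theta>
  have aA: "a \<theta> \<in> A" and bB: "b \<theta> \<in> B" for \<theta> by (auto simp: A_eq B_eq a_def b_def)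
  have norm_a: "norm (a \<theta>) = 1" and norm_b: "norm (b \<theta>) = 1" for \<theta>
    using aA[of \<theta>] bB[of \<theta>] A(2) B(2) by auto
  then have a0: "a \<theta> \<noteq> 0" and b0: "b \<theta> \<noteq> 0" for \<theta>
    by (metis norm_zero zero_neq_one)+
  define j where "j = left_quotient e f"
  define j' where "j' = left_quotient (qcnj e') (qcnj f')"
  have jj: "j \<star> (j \<star> h) = - h" for h using left_quotient(3)[OF ef] by (simp add: j_def)
  have qj: "qcnj j = - j" using qcnj_left_quotient[OF ef(3)] by (simp add: j_def)

  have right: "\<exists>s. b \<theta> = qact j s (b 0)" for \<theta>
    unfolding j_def
    by (rule cliffordian_one_sided[OF K F ef a_def b_def b0 _ cases, where q = q])
      (use zero aA bB in blast)
  have left: "\<exists>s. qcnj (a \<theta>) = qact j' s (qcnj (a 0))" for \<theta>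
    unfolding j'_def
  proof (rule cliffordian_one_sided[OF sphere_chart_qcnj[OF K] F, where q = "qcnj q" and
        a = "\<lambda>\<theta>. qcnj (b \<theta>)" and b = "\<lambda>\<theta>. qcnj (a \<theta>)"])
    show "qcnj (b \<theta>) = qcnj c' + cos \<theta> *\<^sub>R qcnj e' + sin \<theta> *\<^sub>R qcnj f'"
      "qcnj (a \<theta>) = qcnj c + cos \<theta> *\<^sub>R qcnj e + sin \<theta> *\<^sub>R qcnj f" for \<theta>
      by (simp_all add: a_def b_def linear_add[OF linear_qcnj] linear_scale[OF linear_qcnj])
    show "qcnj (a \<theta>) \<noteq> 0" for \<theta> using a0 by (metis norm_eq_zero norm_qcnj)
    show "F (K (qcnj (fst (qcnj (b \<theta>) \<star> qcnj (a \<phi>), 1)), snd (qcnj (b \<theta>) \<star> qcnj (a \<phi>), 1)), 0) = 0"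
      if "qcnj (b \<theta>) \<star> qcnj (a \<phi>) \<noteq> qcnj q" for \<theta> \<phi>
    proof -
      have "a \<phi> \<star> b \<theta> \<noteq> q" using that by (auto simp flip: qcnj_hamilton)
      from zero[OF aA bB this] show ?thesis by (simp flip: qcnj_hamilton)
    qed
    show "qcnj e' \<noteq> 0" using ef'(2) by (metis norm_eq_zero norm_qcnj)
  qed (use ef' cases in simp_all)
  have left: "\<exists>p q. a \<theta> = p *\<^sub>R a 0 - q *\<^sub>R (a 0 \<star> j')" for \<theta>
  proof -
    obtain s where "qcnj (a \<theta>) = qact j' s (qcnj (a 0))"
      using left by blast
    then have "qcnj (qcnj (a \<theta>)) = qcnj (qact j' s (qcnj (a 0)))" by (rule arg_cong)
    also have "\<dots> = Re s *\<^sub>R a 0 + Im s *\<^sub>R (a 0 \<star> qcnj j')"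
      by (simp add: qact_def linear_add[OF linear_qcnj] linear_scale[OF linear_qcnj] qcnj_hamilton)
    also have "qcnj j' = - j'" using qcnj_left_quotient[of "qcnj e'" "qcnj f'"] ef'(3) by (simp add: j'_def)
    finally have "a \<theta> = Re s *\<^sub>R a 0 - Im s *\<^sub>R (a 0 \<star> j')" by (simp add: hamilton_linear)
    then show ?thesis by blast
  qed
  have right: "\<exists>p q. b \<theta> = p *\<^sub>R b 0 + q *\<^sub>R (j \<star> b 0)" for \<theta>
    using right unfolding qact_def by blast

  \<comment> \<open>The direction vectors of \<open>B\<close> lie in \<open>(\<real> + \<real> j) b\<close>, so \<open>j'\<close> lies in \<open>\<real> + \<real> j\<close>.\<close>
  have diff: "\<exists>p q. (1/2) *\<^sub>R (b \<theta> - b \<phi>) = p *\<^sub>R b 0 + q *\<^sub>R (j \<star> b 0)" for \<theta> \<phi>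
  proof -
    obtain p q p' q' where "b \<theta> = p *\<^sub>R b 0 + q *\<^sub>R (j \<star> b 0)" "b \<phi> = p' *\<^sub>R b 0 + q' *\<^sub>R (j \<star> b 0)"
      using right by blast
    then have "(1/2) *\<^sub>R (b \<theta> - b \<phi>) = ((p - p') / 2) *\<^sub>R b 0 + ((q - q') / 2) *\<^sub>R (j \<star> b 0)"
      by (simp add: algebra_simps scaleR_left_diff_distrib diff_divide_distrib)
    then show ?thesis by blast
  qed
  have "b 0 - b pi = e' + e'" "b (pi / 2) - b (- (pi / 2)) = f' + f'"
    by (simp_all add: b_def)
  then have "(1/2) *\<^sub>R (b 0 - b pi) = e'" "(1/2) *\<^sub>R (b (pi / 2) - b (- (pi / 2))) = f'"
    by (simp_all only: scaleR_half_double)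
  then obtain x y x' y' where e': "e' = x *\<^sub>R b 0 + y *\<^sub>R (j \<star> b 0)"
    and f': "f' = x' *\<^sub>R b 0 + y' *\<^sub>R (j \<star> b 0)"
    using diff[of 0 pi] diff[of "pi / 2" "- (pi / 2)"] by auto
  have cancel: "b 0 \<star> (qcnj (b 0) \<star> h) = h" for h
    using norm_b[of 0] by (simp add: hamilton_qcnj_cancel dot_square_norm)
  define \<gamma> \<delta> where "\<gamma> = (x * x' + y * y') / (e' \<bullet> e')" and "\<delta> = (y * x' - x * y') / (e' \<bullet> e')"
  have j': "j' \<star> h = \<gamma> *\<^sub>R h + \<delta> *\<^sub>R (j \<star> h)" for h
  proof -
    have cf: "qcnj f' \<star> h = x' *\<^sub>R (qcnj (b 0) \<star> h) - y' *\<^sub>R (qcnj (b 0) \<star> (j \<star> h))"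
      by (simp add: f' linear_add[OF linear_qcnj] linear_scale[OF linear_qcnj] qcnj_hamilton qj
          hamilton_linear hamilton_assoc)
    have "e' \<star> (qcnj f' \<star> h) = (x * x' + y * y') *\<^sub>R h + (y * x' - x * y') *\<^sub>R (j \<star> h)"
      unfolding cf by (simp add: e' hamilton_linear hamilton_assoc cancel jj algebra_simps)
    moreover have "j' \<star> h = (1 / (e' \<bullet> e')) *\<^sub>R (e' \<star> (qcnj f' \<star> h))"
      by (simp add: j'_def left_quotient_def hamilton_linear hamilton_assoc divide_inverse)
    ultimately show ?thesis by (simp add: \<gamma>_def \<delta>_def scaleR_add_right)
  qed

  define v where "v = a 0 \<star> b 0"
  define w where "w = a 0 \<star> (j \<star> b 0)"
  have vw: "norm v = 1" "norm w = 1" "v \<bullet> w = 0"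
    using norm_a norm_b left_quotient(4)[OF ef] inner_hamilton_imaginary[OF qj]
    by (simp_all add: v_def w_def norm_hamilton inner_hamilton_left flip: j_def)
  have "\<exists>\<theta>. a' \<star> b' = cos \<theta> *\<^sub>R v + sin \<theta> *\<^sub>R w" if ab: "a' \<in> A" "b' \<in> B" for a' b'
  proof -
    obtain \<theta> \<phi> where eqs: "a' = a \<theta>" "b' = b \<phi>" using ab by (auto simp: A_eq B_eq a_def b_def)
    then obtain p q r t where a': "a' = p *\<^sub>R a 0 - q *\<^sub>R (a 0 \<star> j')" and b': "b' = r *\<^sub>R b 0 + t *\<^sub>R (j \<star> b 0)"
      using left[of \<theta>] right[of \<phi>] by blast
    have j'b: "j' \<star> b' = (\<gamma> * r - \<delta> * t) *\<^sub>R b 0 + (\<gamma> * t + \<delta> * r) *\<^sub>R (j \<star> b 0)"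
      by (simp add: j') (simp add: b' hamilton_linear jj algebra_simps)
    have "a' \<star> b' = p *\<^sub>R (a 0 \<star> b') - q *\<^sub>R (a 0 \<star> (j' \<star> b'))"
      by (simp add: a' hamilton_linear hamilton_assoc)
    then have "a' \<star> b' = (p * r - q * (\<gamma> * r - \<delta> * t)) *\<^sub>R v + (p * t - q * (\<gamma> * t + \<delta> * r)) *\<^sub>R w"
      unfolding j'b by (simp add: b' v_def w_def hamilton_linear algebra_simps)
    then obtain P Q where PQ: "a' \<star> b' = P *\<^sub>R v + Q *\<^sub>R w" by blast
    have "norm (a' \<star> b') = 1" using norm_a norm_b eqs by (simp add: norm_hamilton)
    then have "(P *\<^sub>R v + Q *\<^sub>R w) \<bullet> (P *\<^sub>R v + Q *\<^sub>R w) = 1"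
      unfolding PQ[symmetric] by (simp add: norm_eq_1)
    moreover have "v \<bullet> v = 1" "w \<bullet> w = 1" using vw by (simp_all add: norm_eq_1)
    ultimately have "P\<^sup>2 + Q\<^sup>2 = 1"
      using vw(3) by (simp add: inner_add_left inner_add_right inner_commute[of w v] power2_eq_square)
    then obtain \<theta> where "P = cos \<theta>" "Q = sin \<theta>" by (rule sincos_total_2pi) blast
    then show ?thesis using PQ by blast
  qed
  then show ?thesis using that vw by blast
qed

section \<open>Equations of Bohemian surfaces\<close>

lemma frame_coordinates:
  fixes e f g :: "real ^ 3"
  assumes "\<not> dim {e, f, g} < 3"
  shows "\<exists>X Y Z. linear X \<and> linear Y \<and> linear Z \<and>
    (\<forall>w. w = X w *\<^sub>R e + Y w *\<^sub>R f + Z w *\<^sub>R g) \<and>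
    (\<forall>x y z. X (x *\<^sub>R e + y *\<^sub>R f + z *\<^sub>R g) = x \<and>
      Y (x *\<^sub>R e + y *\<^sub>R f + z *\<^sub>R g) = y \<and> Z (x *\<^sub>R e + y *\<^sub>R f + z *\<^sub>R g) = z)"
proof -
  define L where "L p = fst p *\<^sub>R e + fst (snd p) *\<^sub>R f + snd (snd p) *\<^sub>R g" for p
  have L: "linear L" by (rule linearI) (simp_all add: L_def algebra_simps)
  have "{e, f, g} \<subseteq> range L"
  proof -
    have "e = L (1, 0, 0)" "f = L (0, 1, 0)" "g = L (0, 0, 1)" by (simp_all add: L_def)
    then show ?thesis by blast
  qed
  then have "dim {e, f, g} \<le> dim (range L)" by (rule dim_subset)
  then have "dim (range L) = DIM(real ^ 3)" using assms dim_subset_UNIV[of "range L"] by simp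
  moreover have "DIM(real \<times> real \<times> real) = DIM(real ^ 3)" by simp
  ultimately obtain M where M: "linear M" "\<And>x. M (L x) = x" "\<And>y. L (M y) = y"
    using linear_coordinates[OF L] by blast
  show ?thesis
  proof (rule exI[of _ "\<lambda>w. fst (M w)"], rule exI[of _ "\<lambda>w. fst (snd (M w))"],
      rule exI[of _ "\<lambda>w. snd (snd (M w))"], intro conjI allI)
    show "linear (\<lambda>w. fst (M w))" "linear (\<lambda>w. fst (snd (M w)))" "linear (\<lambda>w. snd (snd (M w)))"
      by (auto intro!: linearI simp: linear_add[OF M(1)] linear_scale[OF M(1)])
    show "w = fst (M w) *\<^sub>R e + fst (snd (M w)) *\<^sub>R f + snd (snd (M w)) *\<^sub>R g" for w
      using M(3)[of w] by (simp add: L_def)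
    show "fst (M (x *\<^sub>R e + y *\<^sub>R f + z *\<^sub>R g)) = x" "fst (snd (M (x *\<^sub>R e + y *\<^sub>R f + z *\<^sub>R g))) = y"
      "snd (snd (M (x *\<^sub>R e + y *\<^sub>R f + z *\<^sub>R g))) = z" for x y z
      using M(2)[of "(x, y, z)"] by (simp_all add: L_def)
  qed
qed

text \<open>The form on the light cone that represents the affine function \<open>X (x - c)\<close>.\<close>

definition affine_form :: "('a::real_vector \<Rightarrow> real) \<Rightarrow> 'a \<Rightarrow> 'a \<times> real \<times> real \<Rightarrow> real" where
  "affine_form X c z = X (fst z) - fst (snd z) * X c"

lemma linear_affine_form: "linear X \<Longrightarrow> linear (affine_form X c)"
  by (rule linearI) (simp_all add: affine_form_def linear_add linear_scale algebra_simps)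

lemma affine_form_lift: "linear X \<Longrightarrow> affine_form X c (lift x) = X (x - c)"
  by (simp add: affine_form_def lift_def linear_diff)

lemma linear_fst_snd: "linear (fst \<circ> snd :: 'a::real_vector \<times> real \<times> real \<Rightarrow> real)"
  by (rule linearI) simp_all

lemma cx_affine_form_infinity:
  assumes "cx (fst \<circ> snd) w = 0"
  shows "cx (affine_form X c) w = Complex (X (fst (fst w))) (X (fst (snd w)))"
  using assms by (simp add: cx_def affine_form_def complex_eq_iff)

lemma quartic_coefficients_eq_0:
  fixes a0 a1 a2 a3 a4 :: complex
  assumes "\<And>t. a0 + a1 * t + a2 * t\<^sup>2 + a3 * t ^ 3 + a4 * t ^ 4 = 0"
  shows "a0 = 0" "a1 = 0" "a2 = 0" "a3 = 0" "a4 = 0"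
proof -
  have "poly [:a0, a1, a2, a3, a4:] t = 0" for t
    using assms[of t] by (simp add: algebra_simps power2_eq_square power3_eq_cube power4_eq_xxxx)
  then have "[:a0, a1, a2, a3, a4:] = 0" by (simp only: poly_all_0_iff_0[symmetric]) simp
  then show "a0 = 0" "a1 = 0" "a2 = 0" "a3 = 0" "a4 = 0" by simp_all
qed

text \<open>
  What distinguishes the equations of Bohemian surfaces: linear forms are the equations of planes,
  which contain isotropic lines and need a separate argument.
\<close>

definition bohemian_form ::
    "(((real ^ 3) \<times> real \<times> real) \<times> ((real ^ 3) \<times> real \<times> real) \<Rightarrow> complex) \<Rightarrow> (real ^ 3) set \<Rightarrow> bool" where
  "bohemian_form F S \<longleftrightarrow> (\<exists>n. real_form n F) \<and> vanishes_on F S \<and>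
     (no_isotropic_line F \<or> (\<exists>l x. linear l \<and> l x \<noteq> 0 \<and> F = cx l))"

lemma planar_form:
  fixes S :: "(real ^ 3) set"
  assumes "dim G < 3" "\<And>x. x \<in> S \<Longrightarrow> x - c \<in> span G"
  shows "\<exists>F. bohemian_form F S"
proof -
  obtain n where n: "n \<noteq> 0" "\<And>y. y \<in> span G \<Longrightarrow> orthogonal n y"
    using orthogonal_to_subspace_exists[of G] assms(1) by auto
  define l where "l = affine_form (\<lambda>x. n \<bullet> x) c"
  have lin: "linear (\<lambda>x. n \<bullet> x)" by (rule linearI) (simp_all add: inner_add_right)
  have "linear l" unfolding l_def by (rule linear_affine_form[OF lin])
  moreover have "vanishes_on (cx l) S"
    using assms(2) n(2) \<open>linear l\<close>
    by (simp add: vanishes_on_def cx_real) (simp add: l_def affine_form_lift[OF lin] orthogonal_def)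
  moreover have "l (n, 0, 0) \<noteq> 0" using n(1) by (simp add: l_def affine_form_def)
  ultimately show ?thesis unfolding bohemian_form_def using real_form.linear by blast
qed

text \<open>
  The only complex lines in the cylinder \<open>X\<^sup>2 + Y\<^sup>2 = 1\<close> are its rulings. They have the real direction
  \<open>g\<close>, which is not isotropic.
\<close>

lemma cylinder_form:
  fixes e f g :: "real ^ 3"
  assumes dim: "\<not> dim {e, f, g} < 3"
    and S: "\<And>x. x \<in> S \<Longrightarrow> \<exists>\<theta> t. x - c = cos \<theta> *\<^sub>R e + sin \<theta> *\<^sub>R f + t *\<^sub>R g"
  shows "\<exists>F. bohemian_form F S"
proof -
  obtain X Y Z where lin: "linear X" "linear Y" "linear Z"
    and expand: "\<And>w. w = X w *\<^sub>R e + Y w *\<^sub>R f + Z w *\<^sub>R g"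
    and coord: "\<And>x y z. X (x *\<^sub>R e + y *\<^sub>R f + z *\<^sub>R g) = x"
      "\<And>x y z. Y (x *\<^sub>R e + y *\<^sub>R f + z *\<^sub>R g) = y"
    using frame_coordinates[OF dim] by blast
  define x y u where "x = cx (affine_form X c)" and "y = cx (affine_form Y c)"
    and "u = cx (fst \<circ> snd :: (real ^ 3) \<times> real \<times> real \<Rightarrow> real)"
  define F where "F z = (x z)\<^sup>2 + (y z)\<^sup>2 - (u z)\<^sup>2" for z
  have lins: "linear (affine_form X c)" "linear (affine_form Y c)"
    using lin linear_affine_form by blast+
  have "real_form 1 x" "real_form 1 y" "real_form 1 u"
    unfolding x_def y_def u_def using lins linear_fst_snd by (blast intro: real_form.linear)+
  then have "real_form (2 * 1) F"
    unfolding F_def by (intro real_form_diff real_form.add real_form_power)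
  moreover have "vanishes_on F S"
    unfolding vanishes_on_def
  proof
    fix p assume "p \<in> S"
    then obtain \<theta> t where p: "p - c = cos \<theta> *\<^sub>R e + sin \<theta> *\<^sub>R f + t *\<^sub>R g" using S by blast
    have "X (p - c) = cos \<theta>" "Y (p - c) = sin \<theta>" unfolding p by (simp_all only: coord)
    then have "F (lift p, 0) = (of_real (cos \<theta>))\<^sup>2 + (of_real (sin \<theta>))\<^sup>2 - 1"
      using lin lins
      by (simp add: F_def x_def y_def u_def cx_real linear_fst_snd affine_form_lift)
        (simp add: lift_def)
    also have "\<dots> = of_real ((cos \<theta>)\<^sup>2 + (sin \<theta>)\<^sup>2) - 1" by (simp only: of_real_add of_real_power)
    finally show "F (lift p, 0) = 0" by simp
  qed
  moreover have "no_isotropic_line F"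
    unfolding no_isotropic_line_def
  proof (intro allI impI, rule ccontr)
    fix z w
    assume u: "cx (fst \<circ> snd) z = 1" "cx (fst \<circ> snd) w = 0"
      and iso: "norm (fst (fst w)) = norm (fst (snd w))" "fst (fst w) \<bullet> fst (snd w) = 0"
      and nz: "fst (fst w) \<noteq> 0"
      and "\<nexists>t. F (z + cscale t w) \<noteq> 0"
    then have zero: "F (z + cscale t w) = 0" for t by blast
    have "((x z)\<^sup>2 + (y z)\<^sup>2 - 1) + 2 * (x z * x w + y z * y w) * t + ((x w)\<^sup>2 + (y w)\<^sup>2) * t\<^sup>2
        + 0 * t ^ 3 + 0 * t ^ 4 = 0" for t
      using zero[of t] u
      by (simp add: F_def x_def y_def u_def cx_add cx_cscale lins linear_fst_snd power2_eq_square algebra_simps)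
    note coeffs = quartic_coefficients_eq_0[OF this]
    have "x z * x w + y z * y w = 0" using coeffs(2) by (metis mult_eq_0_iff zero_neq_numeral)
    then have c: "(x z)\<^sup>2 + (y z)\<^sup>2 = 1" "x z * x w = - (y z * y w)" "(y w)\<^sup>2 = - (x w)\<^sup>2"
      using coeffs(1,3) by (simp_all add: eq_neg_iff_add_eq_0 add.commute)
    have "(x w)\<^sup>2 * ((x z)\<^sup>2 + (y z)\<^sup>2) = (x z * x w)\<^sup>2 + (x w)\<^sup>2 * (y z)\<^sup>2" by (simp add: algebra_simps power_mult_distrib)
    also have "\<dots> = (y z)\<^sup>2 * (y w)\<^sup>2 + (x w)\<^sup>2 * (y z)\<^sup>2" unfolding c(2) by (simp add: power_mult_distrib)
    also have "\<dots> = 0" unfolding c(3) by (simp add: algebra_simps)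
    finally have "x w = 0" unfolding c(1) by simp
    then have "y w = 0" using c(3) by simp
    define d d' where "d = fst (fst w)" and "d' = fst (snd w)"
    have "X d = 0" "X d' = 0" "Y d = 0" "Y d' = 0"
      using \<open>x w = 0\<close> \<open>y w = 0\<close> cx_affine_form_infinity[OF u(2)]
      by (simp_all add: x_def y_def d_def d'_def complex_eq_iff)
    then have d: "d = Z d *\<^sub>R g" "d' = Z d' *\<^sub>R g" using expand[of d] expand[of d'] by simp_all
    have "g \<noteq> 0" using d(1) nz by (auto simp: d_def)
    have "d \<bullet> d' = (Z d *\<^sub>R g) \<bullet> (Z d' *\<^sub>R g)" by (rule arg_cong2[where f = inner, OF d])
    then have "Z d = 0 \<or> Z d' = 0" using iso(2) \<open>g \<noteq> 0\<close> by (auto simp: d_def d'_def)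
    then have "d = 0 \<or> d' = 0" using d by auto
    then show False using iso(1) nz by (auto simp: d_def d'_def)
  qed
  ultimately show ?thesis unfolding bohemian_form_def by blast
qed

text \<open>
  The case of the next lemma in which the direction has \<open>X1 = 0\<close>; the scalars \<open>s0\<close>, \<open>s1\<close>, \<open>m\<close> are the
  remaining coefficients there. Comparing \<open>(s0 s1)\<^sup>2\<close> with \<open>s0\<^sup>2 s1\<^sup>2\<close> forces \<open>m = 0\<close>, so the line lies
  in a plane \<open>X = \<plusminus> 1\<close>, where the quartic is a double circle; and a circle contains no line.
\<close>

lemma torus_line_aux:
  fixes p q m s0 s1 X0 Y0 Z0 Y1 Z1 :: complex
  assumes pq: "p \<noteq> 0" "q \<noteq> 0"
    and m: "m = 1 - X0\<^sup>2"
    and s2: "Z1\<^sup>2 = - (q * Y1\<^sup>2)" and s1: "s1 = 2 * (Z0 * Z1 + q * Y0 * Y1)"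
    and s0: "s0 = Z0\<^sup>2 + p * X0\<^sup>2 + q * Y0\<^sup>2 - p - q"
    and eqs: "s1\<^sup>2 = - (4 * p * q * m * Y1\<^sup>2)" "s0 * s1 = - (4 * p * q * m * Y0 * Y1)"
      "s0\<^sup>2 = 4 * p * q * m * (1 - Y0\<^sup>2)"
  shows "Y1 = 0"
proof (rule ccontr)
  assume Y1: "Y1 \<noteq> 0"
  have "(4 * p * q * m * Y0 * Y1)\<^sup>2 = s0\<^sup>2 * s1\<^sup>2"
    using eqs(2) by (metis power2_minus power_mult_distrib)
  also have "\<dots> = - ((4 * p * q * m)\<^sup>2 * (1 - Y0\<^sup>2) * Y1\<^sup>2)"
    unfolding eqs(1,3) by (simp add: power2_eq_square)
  finally have "(4 * p * q * m)\<^sup>2 * Y1\<^sup>2 = 0"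
    by (simp add: power_mult_distrib algebra_simps)
  then have "m = 0" using pq Y1 by simp
  then have "s0 = 0" "s1 = 0" using eqs by simp_all
  have "X0\<^sup>2 = 1" using m \<open>m = 0\<close> by simp
  then have Z0: "Z0\<^sup>2 = q - q * Y0\<^sup>2" using s0 \<open>s0 = 0\<close> by (simp add: algebra_simps)
  have "Z0 * Z1 + q * Y0 * Y1 = 0" using s1 \<open>s1 = 0\<close> by (metis mult_eq_0_iff zero_neq_numeral)
  then have "Z0 * Z1 = - (q * Y0 * Y1)" by (simp add: eq_neg_iff_add_eq_0)
  then have "Z0\<^sup>2 * Z1\<^sup>2 = q\<^sup>2 * Y0\<^sup>2 * Y1\<^sup>2"
    by (metis power2_minus power_mult_distrib)
  then have "q\<^sup>2 * Y1\<^sup>2 = 0" unfolding s2 Z0 by (simp add: power2_eq_square algebra_simps)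
  then show False using pq Y1 by simp
qed

text \<open>
  Here \<open>p\<close>, \<open>q\<close>, \<open>\<kappa>\<close> are the inner products of the basis vectors of the coordinates \<open>X\<close>, \<open>Y\<close>, and \<open>iso\<close>
  says that the direction is isotropic. The leading coefficient in \<open>t\<close> is then a multiple of
  \<open>(\<kappa>\<^sup>2 - p q) (X1 Y1)\<^sup>2\<close>, hence \<open>X1 = 0\<close> or \<open>Y1 = 0\<close>.
\<close>

lemma torus_contains_no_isotropic_line:
  fixes p q \<kappa> X0 Y0 Z0 X1 Y1 Z1 :: complex
  assumes pq: "p \<noteq> 0" "q \<noteq> 0" "\<kappa>\<^sup>2 \<noteq> p * q"
    and iso: "p * X1\<^sup>2 + q * Y1\<^sup>2 + 2 * \<kappa> * X1 * Y1 + Z1\<^sup>2 = 0"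
    and zero: "\<And>t. ((Z0 + t * Z1)\<^sup>2 - p * (1 - (X0 + t * X1)\<^sup>2) - q * (1 - (Y0 + t * Y1)\<^sup>2))\<^sup>2
      - 4 * p * q * (1 - (X0 + t * X1)\<^sup>2) * (1 - (Y0 + t * Y1)\<^sup>2) = 0"
  shows "X1 = 0 \<and> Y1 = 0 \<and> Z1 = 0"
proof -
  define s0 s1 s2 where "s0 = Z0\<^sup>2 + p * X0\<^sup>2 + q * Y0\<^sup>2 - p - q"
    and "s1 = 2 * (Z0 * Z1 + p * X0 * X1 + q * Y0 * Y1)" and "s2 = Z1\<^sup>2 + p * X1\<^sup>2 + q * Y1\<^sup>2"
  define m l where "m = 1 - X0\<^sup>2" and "l = 1 - Y0\<^sup>2"
  have S: "(Z0 + t * Z1)\<^sup>2 - p * (1 - (X0 + t * X1)\<^sup>2) - q * (1 - (Y0 + t * Y1)\<^sup>2) = s0 + s1 * t + s2 * t\<^sup>2" for t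
    by (simp add: s0_def s1_def s2_def power2_eq_square algebra_simps)
  have M: "1 - (X0 + t * X1)\<^sup>2 = m - 2 * X0 * X1 * t - X1\<^sup>2 * t\<^sup>2"
    "1 - (Y0 + t * Y1)\<^sup>2 = l - 2 * Y0 * Y1 * t - Y1\<^sup>2 * t\<^sup>2" for t
    by (simp_all add: m_def l_def power2_eq_square algebra_simps)
  have "(s0\<^sup>2 - 4 * p * q * m * l) + (2 * s0 * s1 + 8 * p * q * (m * Y0 * Y1 + l * X0 * X1)) * t
      + (s1\<^sup>2 + 2 * s0 * s2 + 4 * p * q * (m * Y1\<^sup>2 + l * X1\<^sup>2 - 4 * X0 * X1 * Y0 * Y1)) * t\<^sup>2
      + (2 * s1 * s2 - 8 * p * q * X1 * Y1 * (X0 * Y1 + Y0 * X1)) * t ^ 3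
      + (s2\<^sup>2 - 4 * p * q * X1\<^sup>2 * Y1\<^sup>2) * t ^ 4 = 0" for t
    using zero[of t] unfolding S unfolding M
    by (simp add: power2_eq_square power3_eq_cube power4_eq_xxxx algebra_simps)
  note coeffs = quartic_coefficients_eq_0[OF this]
  have "s2 = - (2 * \<kappa> * X1 * Y1)"
    using iso by (simp add: s2_def eq_neg_iff_add_eq_0 algebra_simps)
  then have "4 * (\<kappa>\<^sup>2 - p * q) * (X1\<^sup>2 * Y1\<^sup>2) = 0"
    using coeffs(5) by (simp add: power_mult_distrib algebra_simps)
  then have XY: "X1 = 0 \<or> Y1 = 0" using pq(3) by simp
  then have "s2 = 0" using \<open>s2 = - (2 * \<kappa> * X1 * Y1)\<close> by auto
  have "X1 = 0 \<and> Y1 = 0"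
  proof (cases "X1 = 0")
    case True
    have "Y1 = 0"
    proof (rule torus_line_aux[OF pq(1,2) m_def _ _ s0_def, of Z1 Y1 s1])
      show "Z1\<^sup>2 = - (q * Y1\<^sup>2)" using \<open>s2 = 0\<close> True by (simp add: s2_def eq_neg_iff_add_eq_0)
      show "s1 = 2 * (Z0 * Z1 + q * Y0 * Y1)" using True by (simp add: s1_def)
      show "s1\<^sup>2 = - (4 * p * q * m * Y1\<^sup>2)" "s0\<^sup>2 = 4 * p * q * m * (1 - Y0\<^sup>2)"
        using coeffs(1,3) True \<open>s2 = 0\<close> by (simp_all add: l_def eq_neg_iff_add_eq_0 algebra_simps)
      have "2 * (s0 * s1 + 4 * p * q * m * Y0 * Y1) = 0"
        using coeffs(2) True by (simp add: algebra_simps)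
      then show "s0 * s1 = - (4 * p * q * m * Y0 * Y1)"
        by (simp only: mult_eq_0_iff eq_neg_iff_add_eq_0) simp
    qed
    with True show ?thesis by simp
  next
    case False
    then have Y: "Y1 = 0" using XY by simp
    have "X1 = 0"
    proof (rule torus_line_aux[OF pq(2,1) l_def, of Z1 X1 s1 Z0 X0 s0])
      show "s0 = Z0\<^sup>2 + q * Y0\<^sup>2 + p * X0\<^sup>2 - q - p" by (simp add: s0_def)
      show "Z1\<^sup>2 = - (p * X1\<^sup>2)" using \<open>s2 = 0\<close> Y by (simp add: s2_def eq_neg_iff_add_eq_0)
      show "s1 = 2 * (Z0 * Z1 + p * X0 * X1)" using Y by (simp add: s1_def)
      show "s1\<^sup>2 = - (4 * q * p * l * X1\<^sup>2)" "s0\<^sup>2 = 4 * q * p * l * (1 - X0\<^sup>2)"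
        using coeffs(1,3) Y \<open>s2 = 0\<close> by (simp_all add: m_def eq_neg_iff_add_eq_0 algebra_simps)
      have "2 * (s0 * s1 + 4 * q * p * l * X0 * X1) = 0"
        using coeffs(2) Y by (simp add: algebra_simps)
      then show "s0 * s1 = - (4 * q * p * l * X0 * X1)"
        by (simp only: mult_eq_0_iff eq_neg_iff_add_eq_0) simp
    qed
    with Y show ?thesis by simp
  qed
  then show ?thesis using iso by simp
qed

text \<open>
  The sum of two circles in planes that meet in the direction \<open>g\<close>. In coordinates
  \<open>X = cos \<theta>\<close>, \<open>Y = cos \<phi>\<close>, \<open>Z = \<bar>e\<bar> sin \<theta> + \<bar>f\<bar> sin \<phi>\<close>, squaring twice eliminates the sines. The
  vectors \<open>e\<close> and \<open>f\<close> are not normalized: their norms are the radii.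
\<close>

lemma torus_form:
  fixes e f g :: "real ^ 3"
  assumes dim: "\<not> dim {e, f, g} < 3" and g: "norm g = 1" "e \<bullet> g = 0" "f \<bullet> g = 0"
    and S: "\<And>x. x \<in> S \<Longrightarrow> \<exists>\<theta> \<phi>. x - c =
      cos \<theta> *\<^sub>R e + cos \<phi> *\<^sub>R f + (norm e * sin \<theta> + norm f * sin \<phi>) *\<^sub>R g"
  shows "\<exists>F. bohemian_form F S"
proof -
  obtain X Y Z where lin: "linear X" "linear Y" "linear Z"
    and expand: "\<And>w. w = X w *\<^sub>R e + Y w *\<^sub>R f + Z w *\<^sub>R g"
    and coord: "\<And>x y z. X (x *\<^sub>R e + y *\<^sub>R f + z *\<^sub>R g) = x"
      "\<And>x y z. Y (x *\<^sub>R e + y *\<^sub>R f + z *\<^sub>R g) = y"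
      "\<And>x y z. Z (x *\<^sub>R e + y *\<^sub>R f + z *\<^sub>R g) = z"
    using frame_coordinates[OF dim] by blast
  define p q \<kappa> where "p = e \<bullet> e" and "q = f \<bullet> f" and "\<kappa> = e \<bullet> f"
  have gg: "g \<bullet> g = 1" using g(1) by (simp add: norm_eq_1)
  have inner: "a \<bullet> b = p * (X a * X b) + q * (Y a * Y b) + \<kappa> * (X a * Y b + Y a * X b) + Z a * Z b" for a b
  proof -
    have "a \<bullet> b = (X a *\<^sub>R e + Y a *\<^sub>R f + Z a *\<^sub>R g) \<bullet> (X b *\<^sub>R e + Y b *\<^sub>R f + Z b *\<^sub>R g)"
      by (rule arg_cong2[where f = inner, OF expand expand])
    then show ?thesis
      by (simp add: inner_add_left inner_add_right p_def q_def \<kappa>_def gg g inner_commute[of g e]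
          inner_commute[of g f] inner_commute[of f e] algebra_simps)
  qed
  have "e \<noteq> 0" using coord(1)[of 1 0 0] coord(1)[of 0 0 0] by auto
  have "f \<noteq> 0" using coord(2)[of 0 1 0] coord(2)[of 0 0 0] by auto
  have pos: "p \<noteq> 0" "q \<noteq> 0" using \<open>e \<noteq> 0\<close> \<open>f \<noteq> 0\<close> by (simp_all add: p_def q_def)
  have pq: "\<kappa>\<^sup>2 \<noteq> p * q"
  proof
    assume eq: "\<kappa>\<^sup>2 = p * q"
    define v where "v = q *\<^sub>R e + (- \<kappa>) *\<^sub>R f + 0 *\<^sub>R g"
    have "v \<bullet> v = q * (p * q - \<kappa>\<^sup>2)"
      unfolding v_def inner coord by (simp add: power2_eq_square algebra_simps)
    then have "v = 0" using eq by simp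
    then have "q = 0" using coord(1)[of q "- \<kappa>" 0] linear_0[OF lin(1)] by (simp add: v_def)
    then show False using pos by simp
  qed

  define x y z u where "x = cx (affine_form X c)" and "y = cx (affine_form Y c)"
    and "z = cx (affine_form Z c)" and "u = cx (fst \<circ> snd :: (real ^ 3) \<times> real \<times> real \<Rightarrow> real)"
  have lins: "linear (affine_form X c)" "linear (affine_form Y c)" "linear (affine_form Z c)"
    using lin linear_affine_form by blast+
  define F where "F v = ((z v)\<^sup>2 - of_real p * ((u v)\<^sup>2 - (x v)\<^sup>2) - of_real q * ((u v)\<^sup>2 - (y v)\<^sup>2))\<^sup>2
    - of_real (4 * p * q) * (((u v)\<^sup>2 - (x v)\<^sup>2) * ((u v)\<^sup>2 - (y v)\<^sup>2))" for v
  have "real_form 1 x" "real_form 1 y" "real_form 1 z" "real_form 1 u"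
    unfolding x_def y_def z_def u_def using lins linear_fst_snd by (blast intro: real_form.linear)+
  then have 2: "real_form (2 * 1) (\<lambda>v. (x v)\<^sup>2)" "real_form (2 * 1) (\<lambda>v. (y v)\<^sup>2)"
    "real_form (2 * 1) (\<lambda>v. (z v)\<^sup>2)" "real_form (2 * 1) (\<lambda>v. (u v)\<^sup>2)"
    by (simp_all only: real_form_power)
  have "real_form (2 * (2 * 1)) (\<lambda>v. ((z v)\<^sup>2 - of_real p * ((u v)\<^sup>2 - (x v)\<^sup>2) - of_real q * ((u v)\<^sup>2 - (y v)\<^sup>2))\<^sup>2)"
    by (intro real_form_power real_form_diff real_form_scale 2)
  moreover have "real_form (2 * (2 * 1)) (\<lambda>v. ((u v)\<^sup>2 - (x v)\<^sup>2) * ((u v)\<^sup>2 - (y v)\<^sup>2))"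
    using real_form.mult[OF real_form_diff[OF 2(4,1)] real_form_diff[OF 2(4,2)]] by simp
  ultimately have "real_form (2 * (2 * 1)) F"
    unfolding F_def by (intro real_form_diff real_form_scale)

  moreover have "vanishes_on F S"
    unfolding vanishes_on_def
  proof
    fix s assume "s \<in> S"
    then obtain \<theta> \<phi> where s: "s - c = cos \<theta> *\<^sub>R e + cos \<phi> *\<^sub>R f + (norm e * sin \<theta> + norm f * sin \<phi>) *\<^sub>R g"
      using S by blast
    have "X (s - c) = cos \<theta>" "Y (s - c) = cos \<phi>" "Z (s - c) = norm e * sin \<theta> + norm f * sin \<phi>"
      unfolding s by (simp_all only: coord)
    then have "F (lift s, 0) = of_real (((norm e * sin \<theta> + norm f * sin \<phi>)\<^sup>2 - p * (1 - (cos \<theta>)\<^sup>2) - q * (1 - (cos \<phi>)\<^sup>2))\<^sup>2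
      - 4 * p * q * ((1 - (cos \<theta>)\<^sup>2) * (1 - (cos \<phi>)\<^sup>2)))"
      using lin lins
      by (simp add: F_def x_def y_def z_def u_def cx_real linear_fst_snd affine_form_lift)
        (simp add: lift_def)
    also have "(norm e * sin \<theta> + norm f * sin \<phi>)\<^sup>2 - p * (1 - (cos \<theta>)\<^sup>2) - q * (1 - (cos \<phi>)\<^sup>2)
        = 2 * (norm e * sin \<theta>) * (norm f * sin \<phi>)"
      unfolding sin_squared_eq[symmetric] p_def q_def
      by (simp add: dot_square_norm power2_sum power_mult_distrib)
    also have "(2 * (norm e * sin \<theta>) * (norm f * sin \<phi>))\<^sup>2 - 4 * p * q * ((1 - (cos \<theta>)\<^sup>2) * (1 - (cos \<phi>)\<^sup>2)) = 0"
      unfolding sin_squared_eq[symmetric] p_def q_def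
      by (simp add: dot_square_norm power_mult_distrib)
    finally show "F (lift s, 0) = 0" by simp
  qed

  moreover have "no_isotropic_line F"
    unfolding no_isotropic_line_def
  proof (intro allI impI, rule ccontr)
    fix v w
    assume u: "cx (fst \<circ> snd) v = 1" "cx (fst \<circ> snd) w = 0"
      and iso: "norm (fst (fst w)) = norm (fst (snd w))" "fst (fst w) \<bullet> fst (snd w) = 0"
      and nz: "fst (fst w) \<noteq> 0"
      and "\<nexists>t. F (v + cscale t w) \<noteq> 0"
    then have zero: "F (v + cscale t w) = 0" for t by blast
    define d d' where "d = fst (fst w)" and "d' = fst (snd w)"
    have xw: "x w = Complex (X d) (X d')" "y w = Complex (Y d) (Y d')" "z w = Complex (Z d) (Z d')"
      using cx_affine_form_infinity[OF u(2)] by (simp_all add: x_def y_def z_def d_def d'_def)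
    have dd: "d \<bullet> d = d' \<bullet> d'" "d \<bullet> d' = 0"
      using iso by (simp_all add: d_def d'_def norm_eq)
    have "of_real p * (x w)\<^sup>2 + of_real q * (y w)\<^sup>2 + 2 * of_real \<kappa> * x w * y w + (z w)\<^sup>2
        = Complex (d \<bullet> d - d' \<bullet> d') (2 * (d \<bullet> d'))"
      unfolding xw inner by (simp add: complex_eq_iff power2_eq_square algebra_simps)
    then have q0: "of_real p * (x w)\<^sup>2 + of_real q * (y w)\<^sup>2 + 2 * of_real \<kappa> * x w * y w + (z w)\<^sup>2 = 0"
      using dd by (simp add: complex_eq_iff)
    have "x w = 0 \<and> y w = 0 \<and> z w = 0"
    proof (rule torus_contains_no_isotropic_line[OF _ _ _ q0])
      show "complex_of_real p \<noteq> 0" "complex_of_real q \<noteq> 0" using pos by simp_all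
      show "(complex_of_real \<kappa>)\<^sup>2 \<noteq> of_real p * of_real q"
        using pq by (metis of_real_eq_iff of_real_mult of_real_power)
      show "((z v + t * z w)\<^sup>2 - of_real p * (1 - (x v + t * x w)\<^sup>2) - of_real q * (1 - (y v + t * y w)\<^sup>2))\<^sup>2
        - 4 * of_real p * of_real q * (1 - (x v + t * x w)\<^sup>2) * (1 - (y v + t * y w)\<^sup>2) = 0" for t
        using zero[of t] u
        by (simp add: F_def x_def y_def z_def u_def cx_add cx_cscale lins linear_fst_snd mult.assoc)
    qed
    then have "X d = 0" "Y d = 0" "Z d = 0" unfolding xw by (simp_all add: complex_eq_iff)
    then have "d = 0" using expand[of d] by simp
    then show False using nz by (simp add: d_def)
  qed
  ultimately show ?thesis unfolding bohemian_form_def by blast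
qed

lemma line_direction:
  fixes L :: "(real ^ 3) set"
  assumes "line L"
  shows "\<exists>c g. \<forall>x\<in>L. \<exists>t. x = c + t *\<^sub>R g"
proof -
  have L: "affine L" "aff_dim L = 1" using assms by (auto simp: line_def)
  then obtain c where c: "c \<in> L" using aff_dim_empty[of L] by fastforce
  define S where "S = (+) (- c) ` L"
  have S: "subspace S" using affine_diffs_subspace[OF L(1) c] by (simp add: S_def)
  have "aff_dim S = 1" unfolding S_def aff_dim_translation_eq by (rule L(2))
  then have "dim S = 1" using aff_dim_subspace[OF S] by simp
  then obtain g where g: "g \<in> S" "norm g = 1" using unit_vector_in_subspace[OF S] by auto
  have "g \<noteq> 0" using g(2) by auto
  then have "S \<subseteq> span {g}"
    using g(1) \<open>dim S = 1\<close> by (intro card_ge_dim_independent) auto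
  then have "\<exists>t. x = c + t *\<^sub>R g" if xL: "x \<in> L" for x
  proof -
    have "x - c \<in> S" using xL by (auto simp: S_def image_iff intro!: bexI[of _ x])
    then obtain t where "x - c = t *\<^sub>R g" using \<open>S \<subseteq> span {g}\<close> by (auto simp: span_singleton)
    then have "x = c + t *\<^sub>R g" by (simp add: algebra_simps)
    then show ?thesis by blast
  qed
  then show ?thesis by blast
qed

lemma circle_line_form:
  assumes "circle A" "line B"
  shows "\<exists>F. bohemian_form F {a + b | a b. a \<in> A \<and> b \<in> B}" (is "\<exists>F. bohemian_form F ?S")
proof -
  obtain c e f where A: "A = range (\<lambda>\<theta>. c + cos \<theta> *\<^sub>R e + sin \<theta> *\<^sub>R f)"
    by (rule circle_parametrization[OF assms(1)])
  obtain c' g where B: "\<And>x. x \<in> B \<Longrightarrow> \<exists>t. x = c' + t *\<^sub>R g"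
    using line_direction[OF assms(2)] by blast
  have S: "\<exists>\<theta> t. x - (c + c') = cos \<theta> *\<^sub>R e + sin \<theta> *\<^sub>R f + t *\<^sub>R g" if xS: "x \<in> ?S" for x
  proof -
    obtain a b where ab: "a \<in> A" "b \<in> B" "x = a + b" using xS by blast
    obtain \<theta> where "a = c + cos \<theta> *\<^sub>R e + sin \<theta> *\<^sub>R f" using ab(1) A by blast
    moreover obtain t where "b = c' + t *\<^sub>R g" using B[OF ab(2)] by blast
    ultimately have "x - (c + c') = cos \<theta> *\<^sub>R e + sin \<theta> *\<^sub>R f + t *\<^sub>R g" using ab(3) by simp
    then show ?thesis by blast
  qed
  show ?thesis
  proof (cases "dim {e, f, g} < 3")
    case True
    then show ?thesis
    proof (rule planar_form)
      fix x assume "x \<in> ?S"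
      then obtain \<theta> t where "x - (c + c') = cos \<theta> *\<^sub>R e + sin \<theta> *\<^sub>R f + t *\<^sub>R g" using S by blast
      then show "x - (c + c') \<in> span {e, f, g}"
        by (simp add: span_add span_scale span_base)
    qed
  next
    case False
    then show ?thesis using S by (rule cylinder_form)
  qed
qed

lemma circle_circle_form:
  fixes A B :: "(real ^ 3) set"
  assumes "circle A" "circle B"
  shows "\<exists>F. bohemian_form F {a + b | a b. a \<in> A \<and> b \<in> B}" (is "\<exists>F. bohemian_form F ?S")
proof -
  obtain c S r where S: "subspace S" "dim S = 2" "r > 0" "\<And>x. x \<in> A \<longleftrightarrow> x - c \<in> S \<and> norm (x - c) = r"
    using circle_subspace[OF assms(1)] by metis
  obtain c' S' r' where S': "subspace S'" "dim S' = 2" "r' > 0" "\<And>x. x \<in> B \<longleftrightarrow> x - c' \<in> S' \<and> norm (x - c') = r'"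
    using circle_subspace[OF assms(2)] by metis
  have "dim (S \<inter> S') > 0"
    using dim_sums_Int[OF S(1) S'(1)] S(2) S'(2) dim_subset_UNIV[of "{x + y |x y. x \<in> S \<and> y \<in> S'}"] by simp
  then obtain g where g: "g \<in> S" "g \<in> S'" "norm g = 1"
    using unit_vector_in_subspace[OF subspace_inter[OF S(1) S'(1)]] by auto
  obtain e where e: "norm e = 1" "e \<bullet> g = 0"
    "\<And>w r. r > 0 \<Longrightarrow> w \<in> S \<and> norm w = r \<longleftrightarrow> (\<exists>\<theta>. w = cos \<theta> *\<^sub>R (r *\<^sub>R e) + sin \<theta> *\<^sub>R (r *\<^sub>R g))"
    using circle_frame[OF S(1,2) g(1,3)] by metis
  obtain f where f: "norm f = 1" "f \<bullet> g = 0"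
    "\<And>w r. r > 0 \<Longrightarrow> w \<in> S' \<and> norm w = r \<longleftrightarrow> (\<exists>\<theta>. w = cos \<theta> *\<^sub>R (r *\<^sub>R f) + sin \<theta> *\<^sub>R (r *\<^sub>R g))"
    using circle_frame[OF S'(1,2) g(2,3)] by metis
  define e' f' where "e' = r *\<^sub>R e" and "f' = r' *\<^sub>R f"
  have norms: "norm e' = r" "norm f' = r'" using S(3) S'(3) e(1) f(1) by (simp_all add: e'_def f'_def)
  have sum: "\<exists>\<theta> \<phi>. x - (c + c') = cos \<theta> *\<^sub>R e' + cos \<phi> *\<^sub>R f' + (norm e' * sin \<theta> + norm f' * sin \<phi>) *\<^sub>R g"
    if xS: "x \<in> ?S" for x
  proof -
    obtain a b where ab: "a \<in> A" "b \<in> B" "x = a + b" using xS by blast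
    obtain \<theta> where a: "a - c = cos \<theta> *\<^sub>R (r *\<^sub>R e) + sin \<theta> *\<^sub>R (r *\<^sub>R g)" using ab(1) S(4) e(3)[OF S(3)] by blast
    obtain \<phi> where b: "b - c' = cos \<phi> *\<^sub>R (r' *\<^sub>R f) + sin \<phi> *\<^sub>R (r' *\<^sub>R g)" using ab(2) S'(4) f(3)[OF S'(3)] by blast
    have "x - (c + c') = (a - c) + (b - c')" using ab(3) by simp
    also have "\<dots> = cos \<theta> *\<^sub>R e' + cos \<phi> *\<^sub>R f' + (norm e' * sin \<theta> + norm f' * sin \<phi>) *\<^sub>R g"
      unfolding a b norms by (simp add: e'_def f'_def algebra_simps)
    finally show ?thesis by blast
  qed
  show ?thesis
  proof (cases "dim {e', f', g} < 3")
    case True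
    then show ?thesis
    proof (rule planar_form)
      fix x assume "x \<in> ?S"
      then obtain \<theta> \<phi> where "x - (c + c') = cos \<theta> *\<^sub>R e' + cos \<phi> *\<^sub>R f' + (norm e' * sin \<theta> + norm f' * sin \<phi>) *\<^sub>R g"
        using sum by blast
      then show "x - (c + c') \<in> span {e', f', g}"
        by (simp add: span_add span_scale span_base)
    qed
  next
    case False
    have "e' \<bullet> g = 0" "f' \<bullet> g = 0" using e(2) f(2) by (simp_all add: e'_def f'_def)
    from torus_form[OF False g(3) this sum] show ?thesis by blast
  qed
qed

lemma line_line_form:
  assumes "line A" "line B"
  shows "\<exists>F. bohemian_form F {a + b | a b. a \<in> A \<and> b \<in> B}" (is "\<exists>F. bohemian_form F ?S")
proof -
  obtain c e where A: "\<And>x. x \<in> A \<Longrightarrow> \<exists>t. x = c + t *\<^sub>R e" using line_direction[OF assms(1)] by blast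
  obtain c' f where B: "\<And>x. x \<in> B \<Longrightarrow> \<exists>t. x = c' + t *\<^sub>R f" using line_direction[OF assms(2)] by blast
  have "dim {e, f} \<le> card {e, f}" by (rule dim_le_card') simp
  also have "\<dots> \<le> 2" by (cases "e = f") simp_all
  finally have "dim {e, f} < 3" by simp
  then show ?thesis
  proof (rule planar_form)
    fix x assume "x \<in> ?S"
    then obtain a b where ab: "a \<in> A" "b \<in> B" "x = a + b" by blast
    obtain s t where "a = c + s *\<^sub>R e" "b = c' + t *\<^sub>R f" using A[OF ab(1)] B[OF ab(2)] by blast
    then have "x - (c + c') = s *\<^sub>R e + t *\<^sub>R f" using ab(3) by simp
    then show "x - (c + c') \<in> span {e, f}" by (simp add: span_add span_scale span_base)
  qed
qed

lemma bohemian_has_form: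
  assumes "bohemian Y"
  obtains F where "bohemian_form F Y"
proof -
  obtain A B where AB: "generalized_circle A" "generalized_circle B"
    and Y: "Y = zariski_closure {a + b | a b. a \<in> A \<and> b \<in> B}"
    using assms unfolding bohemian_def by blast
  have swap: "{a + b | a b. a \<in> A \<and> b \<in> B} = {b + a | b a. b \<in> B \<and> a \<in> A}"
    by (auto, (metis add.commute)+)
  have "\<exists>F. bohemian_form F {a + b | a b. a \<in> A \<and> b \<in> B}"
    using AB unfolding generalized_circle_def
  proof (elim disjE)
    assume "line A" "circle B"
    then show ?thesis unfolding swap by (intro circle_line_form)
  qed (intro circle_circle_form circle_line_form line_line_form; assumption)+
  then obtain F where F: "bohemian_form F {a + b | a b. a \<in> A \<and> b \<in> B}" by blast
  then have "bohemian_form F Y"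
    unfolding bohemian_form_def Y using vanishes_on_closure by blast
  then show ?thesis by (rule that)
qed

section \<open>Stereographic coordinates and great circles\<close>

text \<open>
  The stereographic projection becomes linear on the light cone: points of \<open>S\<^sup>3\<close>, with \<open>s = 1\<close>, are sent
  to multiples of the lifts of their projections.
\<close>

definition stereo_chart :: "(real ^ 4) \<times> real \<Rightarrow> (real ^ 3) \<times> real \<times> real" where
  "stereo_chart = (\<lambda>(y, s). (vector [y $ 1, y $ 2, y $ 3], s - y $ 4, s + y $ 4))"

lemma linear_stereo_chart: "linear stereo_chart"
  by (rule linearI)
    (auto simp: stereo_chart_def vec_eq_iff forall_3 algebra_simps split: prod.splits)

lemma lorentz_stereo_chart: "lorentz (stereo_chart (y, s)) = y \<bullet> y - s\<^sup>2"
  by (simp add: lorentz_def stereo_chart_def inner_vec_def sum_3 sum_4 power2_eq_square algebra_simps)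

lemma surj_stereo_chart: "surj stereo_chart"
proof (rule surjI)
  fix z :: "(real ^ 3) \<times> real \<times> real"
  show "stereo_chart (vector [fst z $ 1, fst z $ 2, fst z $ 3, (snd (snd z) - fst (snd z)) / 2],
      (snd (snd z) + fst (snd z)) / 2) = z"
    by (simp add: stereo_chart_def prod_eq_iff vec_eq_iff forall_3 field_simps)
qed

lemma sphere_chart_conformal:
  assumes "conformal T"
  shows "sphere_chart (\<lambda>p. T (stereo_chart p))"
proof -
  obtain k where k: "k \<noteq> 0" "\<And>z. lorentz (T z) = k * lorentz z"
    using assms unfolding conformal_def by blast
  have "lorentz (T (stereo_chart (y, s))) = k * (y \<bullet> y - s\<^sup>2)" for y s
    by (simp add: k lorentz_stereo_chart)
  moreover have "linear (\<lambda>p. T (stereo_chart p))"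
    using linear_compose[OF linear_stereo_chart conformal_linear[OF assms]] by (simp add: o_def)
  moreover have "surj (\<lambda>p. T (stereo_chart p))"
    using comp_surj[OF surj_stereo_chart bij_is_surj[OF conformal_bij[OF assms]]] by (simp add: o_def)
  ultimately show ?thesis unfolding sphere_chart_def using k(1) by blast
qed

lemma height_less_1:
  fixes y :: "real ^ 4"
  assumes "norm y = 1" "y \<noteq> north_pole"
  shows "y $ 4 \<noteq> 1"
proof
  assume y4: "y $ 4 = 1"
  have "(y $ 1)\<^sup>2 + (y $ 2)\<^sup>2 + (y $ 3)\<^sup>2 + (y $ 4)\<^sup>2 = 1"
    using assms(1) by (simp add: norm_eq_1 inner_vec_def sum_4 power2_eq_square)
  then have "(y $ 1)\<^sup>2 + (y $ 2)\<^sup>2 + (y $ 3)\<^sup>2 = 0" using y4 by simp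
  then have "y $ 1 = 0" "y $ 2 = 0" "y $ 3 = 0"
    by (simp_all add: add_nonneg_eq_0_iff)
  then have "y = north_pole" using y4 by (simp add: vec_eq_iff forall_4 axis_def)
  then show False using assms(2) by simp
qed

lemma stereo_chart_eq_lift:
  assumes "norm y = 1" "y \<noteq> north_pole"
  shows "stereo_chart (y, 1) = (1 - y $ 4) *\<^sub>R lift (stereo y)"
proof -
  define d where "d = 1 - y $ 4"
  have d: "d \<noteq> 0" using height_less_1[OF assms] by (simp add: d_def)
  have "(y $ 1)\<^sup>2 + (y $ 2)\<^sup>2 + (y $ 3)\<^sup>2 + (y $ 4)\<^sup>2 = 1"
    using assms(1) by (simp add: norm_eq_1 inner_vec_def sum_4 power2_eq_square)
  then have "(y $ 1)\<^sup>2 + (y $ 2)\<^sup>2 + (y $ 3)\<^sup>2 = d * (1 + y $ 4)"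
    by (simp add: d_def power2_eq_square algebra_simps)
  then have "d * ((y $ 1 / d)\<^sup>2 + (y $ 2 / d)\<^sup>2 + (y $ 3 / d)\<^sup>2) = 1 + y $ 4"
    using d by (simp add: power_divide field_simps power2_eq_square)
  then show ?thesis
    using d
    by (simp add: stereo_chart_def lift_def stereo_def d_def[symmetric] vec_eq_iff forall_3 inner_vec_def sum_3
        power2_eq_square)
qed

text \<open>A polynomial becomes a form on the light cone, which extends it to the points of \<open>S\<^sup>3\<close>.\<close>

lemma polynomial_homogenization:
  assumes "real_polynomial_function (p :: 'a::euclidean_space \<Rightarrow> real)"
  shows "\<exists>n F. real_form n F \<and> (\<forall>x. F (lift x, 0) = of_real (p x))"
  using assms
proof induction
  case (linear f)
  then have f: "linear (\<lambda>z::'a \<times> real \<times> real. f (fst z))"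
    using linear_compose[OF linear_fst, of f] by (simp add: o_def bounded_linear.linear)
  then show ?case
    using real_form.linear[OF f] by (intro exI[of _ 1] exI[of _ "cx (\<lambda>z. f (fst z))"]) (simp add: cx_real lift_def)
next
  case (const c)
  show ?case using real_form.const[of c] by blast
next
  case (add f g)
  then obtain n F m G where F: "real_form n F" "\<And>x. F (lift x, 0) = of_real (f x)"
    and G: "real_form m G" "\<And>x. G (lift x, 0) = of_real (g x)" by blast
  \<comment> \<open>Powers of the coordinate \<open>u\<close>, which is 1 on lifted points, make the degrees agree.\<close>
  define u where "u = cx (fst \<circ> snd :: 'a \<times> real \<times> real \<Rightarrow> real)"
  have u: "real_form 1 u" "\<And>x. u (lift x, 0) = 1"
    using real_form.linear[OF linear_fst_snd] by (simp_all add: u_def cx_real linear_fst_snd lift_def)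
  have "real_form (n + m) (\<lambda>z. F z * u z ^ m)" "real_form (m + n) (\<lambda>z. G z * u z ^ n)"
    using real_form.mult[OF F(1) real_form_power[OF u(1), of m]]
      real_form.mult[OF G(1) real_form_power[OF u(1), of n]] by simp_all
  then have "real_form (n + m) (\<lambda>z. F z * u z ^ m + G z * u z ^ n)"
    using real_form.add by (simp add: add.commute)
  moreover have "F (lift x, 0) * u (lift x, 0) ^ m + G (lift x, 0) * u (lift x, 0) ^ n = of_real (f x + g x)" for x
    by (simp add: F G u)
  ultimately show ?case by blast
next
  case (mult f g)
  then obtain n F m G where F: "real_form n F" "\<And>x. F (lift x, 0) = of_real (f x)"
    and G: "real_form m G" "\<And>x. G (lift x, 0) = of_real (g x)" by blast
  have "F (lift x, 0) * G (lift x, 0) = of_real (f x * g x)" for x by (simp add: F G)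
  then show ?case using real_form.mult[OF F(1) G(1)] by blast
qed

text \<open>
  The image \<open>C\<close> of the great circle is a circle or a line, cut out by the equations of the plane of \<open>v\<close>
  and \<open>w\<close>. On \<open>C\<close> a polynomial is, up to a factor without zeros, a trigonometric polynomial, which has
  finitely many zeros unless it vanishes identically.
\<close>

lemma great_circle_not_surface:
  fixes v w :: "real ^ 4"
  assumes vw: "norm v = 1" "norm w = 1" "v \<bullet> w = 0"
    and S: "\<And>y. y \<in> S \<Longrightarrow> y \<noteq> north_pole \<and> (\<exists>\<theta>. y = cos \<theta> *\<^sub>R v + sin \<theta> *\<^sub>R w)"
  shows "zariski_dim (zariski_closure (stereo ` S)) \<noteq> 2"
proof -
  define k where "k \<theta> = cos \<theta> *\<^sub>R v + sin \<theta> *\<^sub>R w" for \<theta>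
  define y where "y z = (vector [fst z $ 1, fst z $ 2, fst z $ 3, (snd (snd z) - fst (snd z)) / 2] :: real ^ 4)"
    for z :: "(real ^ 3) \<times> real \<times> real"
  define R where "R a = a - (a \<bullet> v) *\<^sub>R v - (a \<bullet> w) *\<^sub>R w" for a
  have vv: "v \<bullet> v = 1" and ww: "w \<bullet> w = 1" and wv: "w \<bullet> v = 0"
    using vw by (simp_all add: norm_eq_1 inner_commute)
  have norm_k: "norm (k \<theta>) = 1" for \<theta>
  proof -
    have "k \<theta> \<bullet> k \<theta> = (cos \<theta>)\<^sup>2 + (sin \<theta>)\<^sup>2"
      unfolding k_def power2_eq_square by (simp add: inner_add_left inner_add_right vv ww wv vw(3))
    then show ?thesis by (simp add: norm_eq_1)
  qed
  have Rk: "R (k \<theta>) = 0" for \<theta>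
    by (simp add: R_def k_def inner_add_left vv ww wv vw(3))
  have y: "linear y"
    by (rule linearI) (simp_all add: y_def vec_eq_iff forall_4 algebra_simps add_divide_distrib diff_divide_distrib)
  have R: "linear R"
    by (rule linearI) (simp_all add: R_def inner_add_left algebra_simps)

  define C where "C = {x. R (y (lift x)) = 0}"
  have C_eq: "C = {x. \<forall>p\<in>(\<lambda>b x. R (y (lift x)) \<bullet> b) ` Basis. p x = 0}"
    by (auto simp: C_def euclidean_all_zero_iff)
  have "real_polynomial_function (\<lambda>x. R (y (lift x)) \<bullet> b)" for b
  proof -
    have "linear (\<lambda>z. R (y z) \<bullet> b)"
      by (rule linearI) (simp_all only: linear_add[OF y] linear_scale[OF y] linear_add[OF R]
          linear_scale[OF R] inner_add_left inner_scaleR_left real_scaleR_def)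
    then show ?thesis by (rule real_polynomial_function_lift)
  qed
  then have "zariski_closed C"
    unfolding zariski_closed_def
    by (intro exI[of _ "(\<lambda>b x. R (y (lift x)) \<bullet> b) ` Basis"] conjI C_eq) blast
  moreover have "stereo ` S \<subseteq> C"
  proof
    fix x assume "x \<in> stereo ` S"
    then obtain \<theta> where x: "x = stereo (k \<theta>)" "k \<theta> \<noteq> north_pole" using S by (auto simp: k_def)
    have "y (stereo_chart (k \<theta>, 1)) = k \<theta>"
      by (simp add: y_def stereo_chart_def vec_eq_iff forall_4)
    then have "(1 - k \<theta> $ 4) *\<^sub>R R (y (lift x)) = 0"
      using stereo_chart_eq_lift[OF norm_k x(2)] Rk[of \<theta>]
      by (simp add: x(1) linear_scale[OF y] linear_scale[OF R, symmetric])
    then show "x \<in> C" using height_less_1[OF norm_k x(2)] by (simp add: C_def)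
  qed
  ultimately have closure: "zariski_closure (stereo ` S) \<subseteq> C" by (rule hull_minimal[rotated])

  have lift_C: "\<exists>\<theta>\<in>{0..<2 * pi}. \<exists>m. m \<noteq> 0 \<and> lift x = m *\<^sub>R stereo_chart (k \<theta>, 1)" if "x \<in> C" for x
  proof -
    define g where "g = y (lift x)"
    define m where "m = (x \<bullet> x + 1) / 2"
    have m: "m > 0" using inner_ge_zero[of x] by (simp add: m_def add_nonneg_pos)
    have "g $ 1 = x $ 1" "g $ 2 = x $ 2" "g $ 3 = x $ 3" "g $ 4 = (x \<bullet> x - 1) / 2"
      by (simp_all add: g_def y_def lift_def)
    moreover have "g \<bullet> g = (g $ 1)\<^sup>2 + (g $ 2)\<^sup>2 + (g $ 3)\<^sup>2 + (g $ 4)\<^sup>2"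
      by (simp add: inner_vec_def sum_4 power2_eq_square)
    moreover have "x \<bullet> x = (x $ 1)\<^sup>2 + (x $ 2)\<^sup>2 + (x $ 3)\<^sup>2"
      by (simp add: inner_vec_def sum_3 power2_eq_square)
    ultimately have "g \<bullet> g = x \<bullet> x + ((x \<bullet> x - 1) / 2)\<^sup>2" by (simp only:)
    also have "\<dots> = m\<^sup>2" by (simp add: m_def power2_eq_square field_simps)
    finally have gg: "g \<bullet> g = m\<^sup>2" .
    have g: "g = (g \<bullet> v) *\<^sub>R v + (g \<bullet> w) *\<^sub>R w"
      using that by (simp add: C_def R_def g_def algebra_simps)
    then have "g \<bullet> g = g \<bullet> ((g \<bullet> v) *\<^sub>R v + (g \<bullet> w) *\<^sub>R w)" by (rule arg_cong)
    then have "(g \<bullet> v)\<^sup>2 + (g \<bullet> w)\<^sup>2 = m\<^sup>2" using gg by (simp add: inner_add_right power2_eq_square)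
    then have "(g \<bullet> v / m)\<^sup>2 + (g \<bullet> w / m)\<^sup>2 = 1" using m by (simp add: power_divide field_simps)
    then obtain \<theta> where "0 \<le> \<theta>" "\<theta> < 2 * pi" "g \<bullet> v / m = cos \<theta>" "g \<bullet> w / m = sin \<theta>"
      by (rule sincos_total_2pi)
    then have \<theta>: "\<theta> \<in> {0..<2 * pi}" "g \<bullet> v = m * cos \<theta>" "g \<bullet> w = m * sin \<theta>"
      using m by (auto simp: field_simps)
    have "g = (m * cos \<theta>) *\<^sub>R v + (m * sin \<theta>) *\<^sub>R w" using g unfolding \<theta>(2,3) .
    then have "g = m *\<^sub>R k \<theta>" by (simp add: k_def scaleR_add_right)
    then have "m *\<^sub>R stereo_chart (k \<theta>, 1) = stereo_chart (g, m)"
      by (simp add: linear_scale[OF linear_stereo_chart, symmetric])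
    also have "\<dots> = lift x"
      by (simp add: stereo_chart_def g_def y_def lift_def m_def vec_eq_iff forall_3 field_simps)
    finally show ?thesis using \<theta>(1) m by (intro bexI[of _ \<theta>] exI[of _ m]) auto
  qed

  show ?thesis
  proof (rule zariski_dim_neq_2_if_finite_zeros)
    fix p x assume p: "real_polynomial_function p" and x: "x \<in> zariski_closure (stereo ` S)" "p x \<noteq> 0"
    obtain n F where F: "real_form n F" "\<And>x. F (lift x, 0) = of_real (p x)"
      using polynomial_homogenization[OF p] by blast
    define Q where "Q \<theta> = F (stereo_chart (k \<theta>, 1), 0)" for \<theta>
    have Q: "Q \<theta> = F (stereo_chart (0, 1) + cos \<theta> *\<^sub>R stereo_chart (v, 0) + sin \<theta> *\<^sub>R stereo_chart (w, 0), 0)" for \<theta>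
      by (simp add: Q_def k_def linear_scale[OF linear_stereo_chart, symmetric]
          linear_add[OF linear_stereo_chart, symmetric])
    have "\<forall>x\<in>C. \<exists>\<theta>. \<theta> \<in> {0..<2 * pi} \<and> (\<exists>m. m \<noteq> 0 \<and> lift x = m *\<^sub>R stereo_chart (k \<theta>, 1))"
      using lift_C by blast
    then obtain t where t: "\<And>x. x \<in> C \<Longrightarrow> t x \<in> {0..<2 * pi}"
      "\<And>x. x \<in> C \<Longrightarrow> \<exists>m. m \<noteq> 0 \<and> lift x = m *\<^sub>R stereo_chart (k (t x), 1)" by metis
    have pQ: "p x = 0 \<longleftrightarrow> Q (t x) = 0" if "x \<in> C" for x
    proof -
      obtain m where "m \<noteq> 0" "lift x = m *\<^sub>R stereo_chart (k (t x), 1)" using t(2)[OF \<open>x \<in> C\<close>] by blast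
      then have "of_real (p x) = of_real m ^ n * Q (t x)"
        using F(2)[of x] real_form_scaleR[OF F(1)] by (simp add: Q_def)
      then show ?thesis using \<open>m \<noteq> 0\<close> by (metis mult_eq_0_iff of_real_eq_0_iff power_not_zero)
    qed
    have inj: "inj_on t C"
    proof (rule inj_onI)
      fix a b assume ab: "a \<in> C" "b \<in> C" "t a = t b"
      obtain m m' where "m \<noteq> 0" "lift a = m *\<^sub>R stereo_chart (k (t b), 1)"
        "m' \<noteq> 0" "lift b = m' *\<^sub>R stereo_chart (k (t b), 1)"
        using t(2)[OF ab(1)] t(2)[OF ab(2)] ab(3) by auto
      then have "m' *\<^sub>R lift a = m *\<^sub>R lift b" by simp
      then show "a = b" using \<open>m \<noteq> 0\<close> by (auto simp: lift_def)
    qed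
    define \<Theta> where "\<Theta> = t ` {a \<in> C. p a = 0}"
    have "finite {a \<in> C. p a = 0}"
    proof (rule ccontr)
      assume "infinite {a \<in> C. p a = 0}"
      moreover have "inj_on t {a \<in> C. p a = 0}" using inj by (rule inj_on_subset) blast
      ultimately have inf: "infinite \<Theta>" unfolding \<Theta>_def by (simp only: finite_image_iff not_False_eq_True)
      have sub: "\<Theta> \<subseteq> {0..<2 * pi}" using t(1) by (auto simp: \<Theta>_def)
      have "Q \<theta> = 0" if "\<theta> \<in> \<Theta>" for \<theta> using that pQ by (auto simp: \<Theta>_def)
      then have "F (stereo_chart (0, 1) + cos \<theta> *\<^sub>R stereo_chart (v, 0) + sin \<theta> *\<^sub>R stereo_chart (w, 0), 0) = 0"
        if "\<theta> \<in> \<Theta>" for \<theta> using that unfolding Q by blast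
      from real_form_on_ellipse(2)[OF F(1) inf sub this] have "Q (t x) = 0" unfolding Q by blast
      moreover have "x \<in> C" using x(1) closure by blast
      ultimately show False using pQ x(2) by blast
    qed
    moreover have "{a \<in> zariski_closure (stereo ` S). p a = 0} \<subseteq> {a \<in> C. p a = 0}"
      using closure by blast
    ultimately show "finite {a \<in> zariski_closure (stereo ` S). p a = 0}" by (rule rev_finite_subset)
  qed
qed

section \<open>Bohemian and Cliffordian surfaces are not Moebius equivalent\<close>

lemma no_bohemian_form_on_cliffordian:
  assumes Y: "cliffordian Y" and T: "conformal T"
    and F: "real_form n F" "vanishes_on (\<lambda>z. F (map_prod T T z)) Y"
    and cases: "no_isotropic_line F \<or> (\<exists>l x. linear l \<and> l x \<noteq> 0 \<and> F = cx l)"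
  shows False
proof -
  obtain A B where A: "circle A" "A \<subseteq> S3" and B: "circle B" "B \<subseteq> S3"
    and Y_eq: "Y = zariski_closure (stereo ` ({a \<star> b | a b. a \<in> A \<and> b \<in> B} - {north_pole}))"
    and surf: "surface Y"
    using Y unfolding cliffordian_def by blast
  define K where "K p = T (stereo_chart p)" for p
  have zero: "F (K (a \<star> b, 1), 0) = 0" if ab: "a \<in> A" "b \<in> B" "a \<star> b \<noteq> north_pole" for a b
  proof -
    have "norm (a \<star> b) = 1" using ab A(2) B(2) by (auto simp: norm_hamilton subset_iff)
    from stereo_chart_eq_lift[OF this ab(3)]
    have "K (a \<star> b, 1) = (1 - (a \<star> b) $ 4) *\<^sub>R T (lift (stereo (a \<star> b)))"
      by (simp add: K_def linear_scale[OF conformal_linear[OF T]])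
    moreover have "stereo (a \<star> b) \<in> Y"
      unfolding Y_eq using ab by (intro hull_inc) blast
    then have "F (T (lift (stereo (a \<star> b))), 0) = 0"
      using F(2) by (simp add: vanishes_on_def linear_0[OF conformal_linear[OF T]])
    ultimately show ?thesis by (simp add: real_form_scaleR[OF F(1)])
  qed
  have K: "sphere_chart K" using sphere_chart_conformal[OF T] by (simp add: K_def[abs_def])
  obtain v w where vw: "norm v = 1" "norm w = 1" "v \<bullet> w = 0"
    "\<And>a b. a \<in> A \<Longrightarrow> b \<in> B \<Longrightarrow> \<exists>\<theta>. a \<star> b = cos \<theta> *\<^sub>R v + sin \<theta> *\<^sub>R w"
    using cliffordian_great_circle[OF K F(1) A B zero cases] by blast
  have "zariski_dim Y \<noteq> 2"
    unfolding Y_eq using vw(4) by (intro great_circle_not_surface[OF vw(1-3)]) blast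
  then show False using surf by (simp add: surface_def)
qed

theorem corollary1:
  fixes Z :: "(real ^ 3) set"
  assumes "darboux_cyclide Z"
  shows "\<not> ((\<exists>Y. bohemian Y \<and> moebius_equivalent Z Y) \<and>
             (\<exists>Y. cliffordian Y \<and> moebius_equivalent Z Y))"
proof
  assume "(\<exists>Y. bohemian Y \<and> moebius_equivalent Z Y) \<and> (\<exists>Y. cliffordian Y \<and> moebius_equivalent Z Y)"
  then obtain Y Y' where Y: "bohemian Y" "moebius_equivalent Z Y" and Y': "cliffordian Y'" "moebius_equivalent Z Y'"
    by blast
  have surf: "surface Z" "surface Y" "surface Y'"
    using assms Y(1) Y'(1) by (simp_all add: darboux_cyclide_def bohemian_def cliffordian_def)
  obtain F where "bohemian_form F Y" by (rule bohemian_has_form[OF Y(1)])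
  then obtain n where F: "real_form n F" "vanishes_on F Y"
    and cases: "no_isotropic_line F \<or> (\<exists>l x. linear l \<and> l x \<noteq> 0 \<and> F = cx l)"
    unfolding bohemian_form_def by blast
  have "moebius_equivalent Y Z" using Y(2) by (auto simp: moebius_equivalent_def)
  from moebius_equivalent_transfer[OF this surf(2,1) F]
  obtain T where T: "conformal T" "vanishes_on (\<lambda>z. F (map_prod T T z)) Z" by blast
  from moebius_equivalent_transfer[OF Y'(2) surf(1,3) real_form_comp[OF F(1) conformal_linear[OF T(1)]] T(2)]
  obtain S where S: "conformal S" "vanishes_on (\<lambda>z. F (map_prod T T (map_prod S S z))) Y'" by blast
  have "(\<lambda>z. F (map_prod T T (map_prod S S z))) = (\<lambda>z. F (map_prod (\<lambda>x. T (S x)) (\<lambda>x. T (S x)) z))"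
    by (simp add: map_prod_def split_def)
  then have "vanishes_on (\<lambda>z. F (map_prod (\<lambda>x. T (S x)) (\<lambda>x. T (S x)) z)) Y'" using S(2) by simp
  from no_bohemian_form_on_cliffordian[OF Y'(1) conformal_comp[OF T(1) S(1)] F(1) this cases]
  show False .
qed

end
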